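(* The wall and chamber structure of $B(n)$ is uniquely determined by conditions coming from thin indecomposables (that is, from thin indecomposable $B(n)$-modules).
   Context: Let $n\ge 1$ and let $\mathbb{k}$ be an algebraically closed field. The quiver $Q(n)$ has vertices $0,1,\dots,n$ and arrows $\alpha_i\colon i+1\to i$, $\beta_i\colon i\to i+1$ for $0\le i\le n-1$. Paths are written right to left ($\gamma\delta$ means first $\delta$, then $\gamma$). $I(n)$ is the ideal of the path algebra $\mathbb{k}Q(n)$ generated by $\beta_i\alpha_i-\alpha_{i+1}\beta_{i+1}$, $\alpha_i\alpha_{i+1}$, $\beta_{i+1}\beta_i$ for $0\le i\le n-2$, together with $\alpha_0\beta_0$. Put $B(n)=\mathbb{k}Q(n)/I(n)$. A $B(n)$-module means a finite-dimensional one, identified with a representation of $Q(n)$ over $\mathbb{k}$ satisfying the relations in $I(n)$; its dimension vector is $\dim M=(\dim M_n,\dim M_{n-1},\dots,\dim M_0)$. A module is thin if the isomorphism classes of its composition factors are all distinct; for $B(n)$-modules this holds if and only if all entries of $\dim M$ are $\le 1$. Let $\langle\cdot,\cdot\rangle$ be the usual scalar product on $\mathbb{R}^{n+1}$. For $v\in\mathbb{R}^{n+1}$, a $B(n)$-module $M$ is $v$-semistable if $\langle v,\dim M\rangle=0$ and $\langle v,\dim N\rangle\le 0$ for every non-zero proper submodule $N$ of $M$. For $M\neq 0$, the stability space of $M$ is $\mathcal{D}(M)=\{v\in\mathbb{R}^{n+1}\mid M\text{ is }v\text{-semistable}\}$; the conditions coming from $M$ are the conditions on $v$ defining $\mathcal{D}(M)$.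 The stability space $\mathcal{D}(M)$ of a non-zero module is called a wall if it has codimension $1$. The chambers are the open connected components of $\mathbb{R}^{n+1}\setminus\overline{\bigcup_M\mathcal{D}(M)}$, the union running over the indecomposable $B(n)$-modules $M$. The wall and chamber structure for $B(n)$ is the combination of all the walls ($\mathcal{D}(M)$ for indecomposable modules $M$) and all the chambers. *)

theory Defs
  imports "HOL-Analysis.Analysis" "HOL-Library.Function_Algebras"
    "HOL-Computational_Algebra.Polynomial"
begin

section \<open>The ambient vector space\<close>

text \<open>
  All vector spaces are taken inside \<open>nat \<Rightarrow> 'a\<close> with pointwise operations. This space is
  infinite-dimensional over \<open>'a\<close>, so it contains a copy of every finite-dimensional space
  (in particular of every quotient of two of its finite-dimensional subspaces), and considering
  only its subspaces loses no finite-dimensional module up to isomorphism. For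
  \<open>'a = real\<close> it also contains the library's \<^term>\<open>Euclidean_space m\<close>.
\<close>

definition fscale :: "'a::field \<Rightarrow> (nat \<Rightarrow> 'a) \<Rightarrow> (nat \<Rightarrow> 'a)" where
  "fscale c x = (\<lambda>i. c * x i)"

global_interpretation fs: vector_space "fscale :: 'a::field \<Rightarrow> (nat \<Rightarrow> 'a) \<Rightarrow> (nat \<Rightarrow> 'a)"
  by unfold_locales (auto simp: fscale_def fun_eq_iff algebra_simps)

abbreviation flinear :: "((nat \<Rightarrow> 'a::field) \<Rightarrow> (nat \<Rightarrow> 'a)) \<Rightarrow> bool" where
  "flinear \<equiv> Vector_Spaces.linear fscale fscale"

definition fin_dim_subspace :: "(nat \<Rightarrow> 'a::field) set \<Rightarrow> bool" where
  "fin_dim_subspace V \<longleftrightarrow> fs.subspace V \<and> (\<exists>B. finite B \<and> V \<subseteq> fs.span B)"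


section \<open>Modules over \<open>B(n)\<close> as representations of \<open>Q(n)\<close>\<close>

text \<open>
  \<open>vsp M i\<close> is the space at vertex \<open>i\<close>; \<open>al M i\<close> and \<open>be M i\<close> are the actions of the arrows
  \<open>\<alpha>\<^sub>i : i+1 \<rightarrow> i\<close> and \<open>\<beta>\<^sub>i : i \<rightarrow> i+1\<close>. Only the components with \<open>i \<le> n\<close> (spaces) and
  \<open>i < n\<close> (maps) matter. Linear maps between the vertex spaces are given as restrictions of
  linear endomorphisms of the ambient space; every linear map between subspaces is of
  this form.
\<close>

record 'k rep =
  vsp :: "nat \<Rightarrow> (nat \<Rightarrow> 'k) set"
  al :: "nat \<Rightarrow> (nat \<Rightarrow> 'k) \<Rightarrow> (nat \<Rightarrow> 'k)"
  be :: "nat \<Rightarrow> (nat \<Rightarrow> 'k) \<Rightarrow> (nat \<Rightarrow> 'k)"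

definition representation :: "nat \<Rightarrow> 'k::field rep \<Rightarrow> bool" where
  "representation n M \<longleftrightarrow>
     (\<forall>i\<le>n. fin_dim_subspace (vsp M i)) \<and>
     (\<forall>i<n. flinear (al M i) \<and> al M i ` vsp M (i+1) \<subseteq> vsp M i) \<and>
     (\<forall>i<n. flinear (be M i) \<and> be M i ` vsp M i \<subseteq> vsp M (i+1))"

text \<open>A path \<open>\<gamma>\<delta>\<close> acts as the composite \<open>\<gamma> \<circ> \<delta>\<close>. The condition \<open>0 \<le> i \<le> n - 2\<close> is
  written \<open>i + 2 \<le> n\<close>.\<close>

definition satisfies_relations :: "nat \<Rightarrow> 'k::field rep \<Rightarrow> bool" where
  "satisfies_relations n M \<longleftrightarrow>
     (\<forall>i. i + 2 \<le> n \<longrightarrow>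
        (\<forall>x\<in>vsp M (i+1). be M i (al M i x) = al M (i+1) (be M (i+1) x)) \<and>
        (\<forall>x\<in>vsp M (i+2). al M i (al M (i+1) x) = 0) \<and>
        (\<forall>x\<in>vsp M i. be M (i+1) (be M i x) = 0)) \<and>
     (\<forall>x\<in>vsp M 0. al M 0 (be M 0 x) = 0)"

definition Bmodule :: "nat \<Rightarrow> 'k::field rep \<Rightarrow> bool" where
  "Bmodule n M \<longleftrightarrow> representation n M \<and> satisfies_relations n M"

definition zero_rep :: "nat \<Rightarrow> 'k::field rep \<Rightarrow> bool" where
  "zero_rep n M \<longleftrightarrow> (\<forall>i\<le>n. vsp M i = {0})"

definition submodule :: "nat \<Rightarrow> 'k::field rep \<Rightarrow> 'k rep \<Rightarrow> bool" where
  "submodule n N M \<longleftrightarrow>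
     al N = al M \<and> be N = be M \<and>
     (\<forall>i\<le>n. fs.subspace (vsp N i) \<and> vsp N i \<subseteq> vsp M i) \<and>
     (\<forall>i<n. al M i ` vsp N (i+1) \<subseteq> vsp N i \<and> be M i ` vsp N i \<subseteq> vsp N (i+1))"

definition proper_submodule :: "nat \<Rightarrow> 'k::field rep \<Rightarrow> 'k rep \<Rightarrow> bool" where
  "proper_submodule n N M \<longleftrightarrow> submodule n N M \<and> (\<exists>i\<le>n. vsp N i \<noteq> vsp M i)"

definition hom :: "nat \<Rightarrow> 'k::field rep \<Rightarrow> 'k rep \<Rightarrow> (nat \<Rightarrow> (nat \<Rightarrow> 'k) \<Rightarrow> (nat \<Rightarrow> 'k)) \<Rightarrow> bool"
  where
  "hom n M N f \<longleftrightarrow>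
     (\<forall>i\<le>n. flinear (f i) \<and> f i ` vsp M i \<subseteq> vsp N i) \<and>
     (\<forall>i<n. (\<forall>x\<in>vsp M (i+1). f i (al M i x) = al N i (f (i+1) x)) \<and>
            (\<forall>x\<in>vsp M i. f (i+1) (be M i x) = be N i (f i x)))"

definition iso :: "nat \<Rightarrow> 'k::field rep \<Rightarrow> 'k rep \<Rightarrow> bool" where
  "iso n M N \<longleftrightarrow> (\<exists>f. hom n M N f \<and> (\<forall>i\<le>n. bij_betw (f i) (vsp M i) (vsp N i)))"

definition indecomposable :: "nat \<Rightarrow> 'k::field rep \<Rightarrow> bool" where
  "indecomposable n M \<longleftrightarrow>
     \<not> zero_rep n M \<and>
     (\<forall>N L. submodule n N M \<and> submodule n L M \<and>
        (\<forall>i\<le>n. vsp N i \<inter> vsp L i = {0} \<and> {x + y | x y. x \<in> vsp N i \<and> y \<in> vsp L i} = vsp M i)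
        \<longrightarrow> zero_rep n N \<or> zero_rep n L)"

definition simple_rep :: "nat \<Rightarrow> 'k::field rep \<Rightarrow> bool" where
  "simple_rep n M \<longleftrightarrow>
     \<not> zero_rep n M \<and> (\<forall>N. proper_submodule n N M \<longrightarrow> zero_rep n N)"

text \<open>\<open>S\<close> is (isomorphic to) the quotient of \<open>N\<close> by its submodule \<open>L\<close>.\<close>

definition is_quotient :: "nat \<Rightarrow> 'k::field rep \<Rightarrow> 'k rep \<Rightarrow> 'k rep \<Rightarrow> bool" where
  "is_quotient n S N L \<longleftrightarrow>
     Bmodule n S \<and>
     (\<exists>f. hom n N S f \<and>
        (\<forall>i\<le>n. f i ` vsp N i = vsp S i \<and> {x \<in> vsp N i. f i x = 0} = vsp L i))"

text \<open>The list \<open>S\<close> consists of the factors of a composition series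
  \<open>0 = U 0 \<subseteq> U 1 \<subseteq> \<dots> \<subseteq> U (length S) = M\<close>.\<close>

definition composition_factors :: "nat \<Rightarrow> 'k::field rep \<Rightarrow> 'k rep list \<Rightarrow> bool" where
  "composition_factors n M S \<longleftrightarrow>
     (\<exists>U. (\<forall>j\<le>length S. submodule n (U j) M) \<and>
          zero_rep n (U 0) \<and> (\<forall>i\<le>n. vsp (U (length S)) i = vsp M i) \<and>
          (\<forall>j<length S. simple_rep n (S ! j) \<and> submodule n (U j) (U (Suc j)) \<and>
             is_quotient n (S ! j) (U (Suc j)) (U j)))"

text \<open>Composition series exist, and by Jordan-Hoelder the choice of one is immaterial.\<close>

definition thin :: "nat \<Rightarrow> 'k::field rep \<Rightarrow> bool" where
  "thin n M \<longleftrightarrow>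
     (\<forall>S. composition_factors n M S \<longrightarrow>
        (\<forall>j k. j < k \<and> k < length S \<longrightarrow> \<not> iso n (S ! j) (S ! k)))"

definition indecomposables :: "nat \<Rightarrow> 'k::field rep set" where
  "indecomposables n = {M. Bmodule n M \<and> indecomposable n M}"

definition thin_indecomposables :: "nat \<Rightarrow> 'k::field rep set" where
  "thin_indecomposables n = {M \<in> indecomposables n. thin n M}"


section \<open>Stability spaces, walls and chambers\<close>

text \<open>\<open>\<real>\<^bsup>n+1\<^esup>\<close> is \<^term>\<open>Euclidean_space (n + 1)\<close>: sequences vanishing from index \<open>n + 1\<close> on.
  Dimension vectors are listed as \<open>(dim M\<^sub>n, \<dots>, dim M\<^sub>0)\<close>, so coordinate \<open>j\<close> belongs to
  vertex \<open>n - j\<close>.\<close>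

definition dimvec :: "nat \<Rightarrow> 'k::field rep \<Rightarrow> nat \<Rightarrow> real" where
  "dimvec n M j = (if j \<le> n then real (fs.dim (vsp M (n - j))) else 0)"

definition scalar_product :: "nat \<Rightarrow> (nat \<Rightarrow> real) \<Rightarrow> (nat \<Rightarrow> real) \<Rightarrow> real" where
  "scalar_product n v w = (\<Sum>j\<le>n. v j * w j)"

definition semistable :: "nat \<Rightarrow> (nat \<Rightarrow> real) \<Rightarrow> 'k::field rep \<Rightarrow> bool" where
  "semistable n v M \<longleftrightarrow>
     scalar_product n v (dimvec n M) = 0 \<and>
     (\<forall>N. proper_submodule n N M \<and> \<not> zero_rep n N \<longrightarrow> scalar_product n v (dimvec n N) \<le> 0)"

definition stability_space :: "nat \<Rightarrow> 'k::field rep \<Rightarrow> (nat \<Rightarrow> real) set" where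
  "stability_space n M = {v \<in> topspace (Euclidean_space (n + 1)). semistable n v M}"

text \<open>A stability space is a convex cone containing \<open>0\<close>, so its dimension is that of its linear
  span, and \<^term>\<open>fs.dim W\<close> is by definition the dimension of the span of \<open>W\<close>.\<close>

definition codimension :: "nat \<Rightarrow> (nat \<Rightarrow> real) set \<Rightarrow> nat" where
  "codimension n W = (n + 1) - fs.dim W"

definition walls :: "nat \<Rightarrow> 'k::field rep set \<Rightarrow> (nat \<Rightarrow> real) set set" where
  "walls n C = {stability_space n M | M. M \<in> C \<and> codimension n (stability_space n M) = 1}"

definition chambers :: "nat \<Rightarrow> 'k::field rep set \<Rightarrow> (nat \<Rightarrow> real) set set" where
  "chambers n C =
     (let E = Euclidean_space (n + 1);
          X = topspace E - (E closure_of (\<Union>M\<in>C. stability_space n M))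
      in {K \<in> connected_components_of (subtopology E X). openin E K})"

text \<open>The walls and chambers defined by the conditions coming from the modules in the class \<open>C\<close>;
  the wall and chamber structure for \<open>B(n)\<close> is the case \<open>C = indecomposables n\<close>.\<close>

definition wall_chamber_structure ::
  "nat \<Rightarrow> 'k::field rep set \<Rightarrow> (nat \<Rightarrow> real) set set \<times> (nat \<Rightarrow> real) set set" where
  "wall_chamber_structure n C = (walls n C, chambers n C)"

end

theory Submission
  imports Defs
begin

text \<open>
  Write \<open>w\<^sub>i = v (n - i)\<close> for the weight that a point \<open>v\<close> puts on the vertex \<open>i\<close>. The proof compares
  arbitrary modules with zigzags. A zigzag of multiplicity \<open>m\<close> on an interval \<open>c..e\<close> of vertices has
  dimension \<open>m\<close> at each vertex of the interval and \<open>0\<close> elsewhere, and between any two neighbouring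
  vertices of the interval (at each gap) one of the two arrows acts bijectively and the other one by zero; the
  relations \<open>\<alpha>\<alpha> = 0 = \<beta>\<beta>\<close> force the directions of the bijective arrows to alternate. The
  stability space of a zigzag consists of the \<open>v\<close> for which the interval has total weight \<open>0\<close> and
  each initial segment \<open>c..q\<close> has a weight of the sign prescribed by the direction of the arrow that
  leaves it or enters it (\<open>stability_space_zigzag\<close>). This cone is the same for every multiplicity, and the
  zigzags of multiplicity \<open>1\<close> are thin and indecomposable. The theorem therefore follows from two facts.

  Every point of every stability space lies in the stability space of a zigzag
  (\<open>semistable_in_zigzag_cone\<close>), so the unions of stability spaces over all indecomposables and over
  the thin ones coincide, and so do the chambers. To see this, let \<open>M\<close> be a non-zero
  \<open>v\<close>-semistable module. A minimal non-zero submodule \<open>N\<close> of weight \<open>0\<close> is stable, and an endomorphism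
  of \<open>N\<close> that kills a non-zero vector vanishes, because the weights of its kernel and of its image
  are non-positive and add up to \<open>0\<close>. This applies to the action of the central nilpotent element
  \<open>\<Sum>\<^sub>i \<beta>\<^sub>i\<alpha>\<^sub>i\<close>, so all paths of length two act on \<open>N\<close> by zero. Then the signs of the weights allow only
  one non-zero arrow between two neighbouring vertices, and \<open>N\<close> is a representation of a quiver of
  type A. Endomorphisms of \<open>N\<close> are the solutions of a linear system in which the unknowns outnumber
  the equations by at least the Euler form of the dimension vector; unless that vector is the
  indicator of an interval, there are enough spare unknowns to find a non-zero endomorphism that
  kills a non-zero vector. As a stable module does not decompose, an arrow is non-zero at each gap of
  the interval. Hence \<open>N\<close> is a zigzag of multiplicity \<open>1\<close>.

  Every stability space of codimension one of a non-zero module \<open>M\<close> is the stability space of a zigzag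
  (\<open>wall_interval_dims\<close> and \<open>wall_zigzag\<close>), so the walls coincide. By the first fact the cone
  \<open>\<D>(M)\<close> is covered by the finitely many hyperplanes on which some interval has weight \<open>0\<close>. A convex
  cone covered by finitely many hyperplanes lies in one of them. As \<open>\<D>(M)\<close> also lies in the
  hyperplane orthogonal to the dimension vector of \<open>M\<close>, and spans it, the two hyperplanes agree and
  the dimension vector is a multiple of the indicator of an interval. If at some gap, the leftmost
  say, neither arrow were bijective, then a kernel and an image there, transported to the left end
  of the interval, would bound the weight of the initial segment from both sides by \<open>0\<close>. This second
  linear equation on \<open>\<D>(M)\<close> contradicts codimension one. So \<open>M\<close> is itself a zigzag.
\<close>

section \<open>Linear algebra in the ambient space\<close>

interpretation fsp: vector_space_pair "fscale :: 'a::field \<Rightarrow> _" "fscale :: 'a \<Rightarrow> _"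
  by unfold_locales

lemma fin_dim_basis:
  assumes "fin_dim_subspace V"
  obtains B where "B \<subseteq> V" "fs.independent B" "fs.span B = V" "finite B" "card B = fs.dim V"
proof -
  from assms obtain F where F: "fs.subspace V" "finite F" "V \<subseteq> fs.span F"
    unfolding fin_dim_subspace_def by blast
  obtain B where B: "B \<subseteq> V" "fs.independent B" "V \<subseteq> fs.span B" "card B = fs.dim V"
    by (rule fs.basis_exists)
  moreover have "finite B"
    using fs.independent_span_bound[OF F(2) B(2)] B(1) F(3) by auto
  moreover have "fs.span B = V"
    using B F(1) by (metis fs.span_subspace)
  ultimately show thesis using that by blast
qed

lemma fin_dim_subspace_subset:
  assumes "fin_dim_subspace V" "fs.subspace U" "U \<subseteq> V"
  shows "fin_dim_subspace U"
  using assms unfolding fin_dim_subspace_def by blast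

lemma basis_extend:
  assumes V: "fin_dim_subspace V" and A: "A \<subseteq> V" "fs.independent A"
  obtains B where "A \<subseteq> B" "B \<subseteq> V" "fs.independent B" "fs.span B = V" "finite B" "card B = fs.dim V"
proof -
  from V obtain F where F: "fs.subspace V" "finite F" "V \<subseteq> fs.span F"
    unfolding fin_dim_subspace_def by blast
  obtain B where B: "A \<subseteq> B" "B \<subseteq> V" "fs.independent B" "V \<subseteq> fs.span B"
    using fs.maximal_independent_subset_extend[OF A] by metis
  moreover have "finite B"
    using fs.independent_span_bound[OF F(2) B(3)] B(2) F(3) by auto
  moreover have "fs.span B = V"
    using B F(1) by (metis fs.span_subspace)
  moreover have "card B = fs.dim V" using B by (simp add: fs.basis_card_eq_dim)
  ultimately show thesis using that by blast
qed

lemma dim_mono_fin: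
  assumes V: "fin_dim_subspace V" and U: "fs.subspace U" "U \<subseteq> V"
  shows "fs.dim U \<le> fs.dim V"
proof -
  obtain A where A: "A \<subseteq> U" "fs.independent A" "fs.span A = U" "finite A" "card A = fs.dim U"
    using fin_dim_basis[OF fin_dim_subspace_subset[OF V U]] by metis
  obtain B where "A \<subseteq> B" "finite B" "card B = fs.dim V"
    using basis_extend[OF V _ A(2)] A(1) U(2) by (metis subset_trans)
  thus ?thesis using A(5) by (metis card_mono)
qed

lemma dim_eq_fin:
  assumes V: "fin_dim_subspace V" and U: "fs.subspace U" "U \<subseteq> V" and d: "fs.dim U = fs.dim V"
  shows "U = V"
proof -
  obtain A where A: "A \<subseteq> U" "fs.independent A" "fs.span A = U" "finite A" "card A = fs.dim U"
    using fin_dim_basis[OF fin_dim_subspace_subset[OF V U]] by metis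
  obtain B where B: "A \<subseteq> B" "finite B" "card B = fs.dim V" "fs.span B = V"
    using basis_extend[OF V _ A(2)] A(1) U(2) by (metis subset_trans)
  hence "A = B" using A(5) d by (metis card_subset_eq)
  thus ?thesis using A B by simp
qed

lemma dim_less_fin:
  assumes "fin_dim_subspace V" "fs.subspace U" "U \<subseteq> V" "U \<noteq> V"
  shows "fs.dim U < fs.dim V"
  using dim_mono_fin[OF assms(1-3)] dim_eq_fin[OF assms(1-3)] assms(4) by linarith

lemma dim_zero_space [simp]: "fs.dim {0} = 0"
  using fs.dim_eq_card_independent[OF fs.independent_empty]
  by (metis card.empty fs.dim_span fs.span_empty)

lemma dim_eq_0_iff:
  assumes "fin_dim_subspace V"
  shows "fs.dim V = 0 \<longleftrightarrow> V = {0}"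
proof
  assume "fs.dim V = 0"
  moreover have "fs.subspace V" using assms by (simp add: fin_dim_subspace_def)
  ultimately show "V = {0}"
    using dim_eq_fin[OF assms fs.subspace_single_0] fs.subspace_0 by fastforce
qed simp

lemma flinear_zero: "flinear f \<Longrightarrow> f 0 = 0"
  by (rule fsp.linear_0)

lemma subspace_ker: "flinear f \<Longrightarrow> fs.subspace V \<Longrightarrow> fs.subspace {x \<in> V. f x = 0}"
  using fsp.linear_subspace_kernel[of f] fs.subspace_inter[of V "{x. f x = 0}"]
  by (simp add: Int_def)

lemma subspace_img: "flinear f \<Longrightarrow> fs.subspace V \<Longrightarrow> fs.subspace (f ` V)"
  by (rule fsp.linear_subspace_image)

lemma subspace_preimage: "flinear f \<Longrightarrow> fs.subspace V \<Longrightarrow> fs.subspace W \<Longrightarrow> fs.subspace {x \<in> V. f x \<in> W}"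
  using fsp.linear_subspace_linear_preimage[of f W] fs.subspace_inter[of V "{x. f x \<in> W}"]
  by (simp add: Int_def)

lemma fin_dim_image:
  assumes "flinear f" "fin_dim_subspace V"
  shows "fin_dim_subspace (f ` V)"
proof -
  obtain B where B: "fs.span B = V" "finite B" using fin_dim_basis[OF assms(2)] by metis
  have "f ` V = fs.span (f ` B)" using fsp.linear_span_image[OF assms(1), of B] B(1) by simp
  thus ?thesis unfolding fin_dim_subspace_def using B(2) by auto
qed

text \<open>The ambient space is infinite-dimensional, so the dimension formula is derived here for a
  finite-dimensional subspace: a basis of the kernel is extended to a basis of \<open>V\<close>, and \<open>f\<close> maps the
  added vectors to a basis of the image.\<close>

lemma rank_nullity:
  assumes f: "flinear f" and V: "fin_dim_subspace V"
  shows "fs.dim V = fs.dim (f ` V) + fs.dim {x \<in> V. f x = 0}"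
proof -
  let ?K = "{x \<in> V. f x = 0}"
  have sV: "fs.subspace V" using V by (simp add: fin_dim_subspace_def)
  have K: "fs.subspace ?K" by (rule subspace_ker[OF f sV])
  obtain A where A: "A \<subseteq> ?K" "fs.independent A" "fs.span A = ?K" "finite A" "card A = fs.dim ?K"
    by (rule fin_dim_basis[OF fin_dim_subspace_subset[OF V K]]) auto
  obtain B where B: "A \<subseteq> B" "B \<subseteq> V" "fs.independent B" "fs.span B = V" "finite B" "card B = fs.dim V"
    using basis_extend[OF V _ A(2)] A(1) by blast
  define C where "C = B - A"
  have C: "fs.independent C" "C \<subseteq> B"
    unfolding C_def by (rule fs.independent_mono[OF B(3)]) auto
  \<comment> \<open>The coordinates of such an \<open>x\<close> with respect to \<open>B\<close> are supported both in \<open>A\<close> and in \<open>B - A\<close>.\<close>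
  have disj: "x = 0" if "x \<in> fs.span C" "x \<in> fs.span A" for x
  proof -
    have "fs.representation B x = fs.representation C x"
      by (rule fs.representation_extend[OF B(3) that(1) C(2)])
    moreover have "fs.representation B x = fs.representation A x"
      by (rule fs.representation_extend[OF B(3) that(2) B(1)])
    ultimately have "fs.representation A x = (\<lambda>b. 0)"
      using fs.representation_ne_zero[of A x] fs.representation_ne_zero[of C x] C_def
      by (intro ext) (metis DiffD2)
    thus ?thesis using fs.sum_nonzero_representation_eq[OF A(2) that(2)] by simp
  qed
  have inj: "inj_on f (fs.span C)"
  proof (rule inj_onI)
    fix x y assume xy: "x \<in> fs.span C" "y \<in> fs.span C" "f x = f y"
    have "x - y \<in> fs.span C" using xy by (simp add: fs.span_diff)
    moreover have "f (x - y) = 0" using xy fsp.linear_diff[OF f] by simp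
    moreover have "fs.span C \<subseteq> V" using C(2) B(4) by (metis fs.span_mono)
    ultimately have "x - y = 0" using disj A(3) by blast
    thus "x = y" by simp
  qed
  have "fs.independent (f ` C)" by (rule fsp.linear_independent_injective_image[OF f C(1) inj])
  moreover have "f ` V \<subseteq> fs.span (f ` C)"
  proof -
    have "f ` V = fs.span (f ` B)" using fsp.linear_span_image[OF f, of B] B(4) by simp
    also have "\<dots> \<subseteq> fs.span (f ` C)"
    proof (rule fs.span_minimal)
      show "f ` B \<subseteq> fs.span (f ` C)"
      proof
        fix y assume "y \<in> f ` B"
        then obtain b where b: "b \<in> B" "y = f b" by blast
        show "y \<in> fs.span (f ` C)"
        proof (cases "b \<in> A")
          case True
          then have "y = 0" using A(1) b by auto
          then show ?thesis by (simp add: fs.span_zero)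
        next
          case False
          then show ?thesis using b by (auto simp: C_def intro: fs.span_base)
        qed
      qed
    qed simp
    finally show ?thesis .
  qed
  moreover have "f ` C \<subseteq> f ` V" using C(2) B(2) by auto
  ultimately have "fs.dim (f ` V) = card (f ` C)" by (metis fs.basis_card_eq_dim)
  also have "\<dots> = card C" using inj fs.span_superset by (metis card_image inj_on_subset)
  finally have "fs.dim (f ` V) = card C" .
  moreover have "card B = card C + card A"
    using card_Diff_subset[OF A(4) B(1)] card_mono[OF B(5,1)] by (simp add: C_def)
  ultimately show ?thesis using A(5) B(6) by simp
qed

lemma dim_image_inj:
  assumes f: "flinear f" and V: "fin_dim_subspace V" and inj: "\<And>x. x \<in> V \<Longrightarrow> f x = 0 \<Longrightarrow> x = 0"
  shows "fs.dim (f ` V) = fs.dim V"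
proof -
  have "{x \<in> V. f x = 0} = {0}"
    using inj flinear_zero[OF f] V fs.subspace_0 by (auto simp: fin_dim_subspace_def)
  thus ?thesis using rank_nullity[OF f V] by simp
qed

lemma inj_on_ker: "flinear f \<Longrightarrow> fs.subspace V \<Longrightarrow> inj_on f V \<longleftrightarrow> (\<forall>x\<in>V. f x = 0 \<longrightarrow> x = 0)"
proof
  assume f: "flinear f" "fs.subspace V" and k: "\<forall>x\<in>V. f x = 0 \<longrightarrow> x = 0"
  show "inj_on f V"
  proof (rule inj_onI)
    fix x y assume xy: "x \<in> V" "y \<in> V" "f x = f y"
    have "x - y \<in> V" "f (x - y) = 0" using xy f by (auto simp: fs.subspace_diff fsp.linear_diff)
    thus "x = y" using k by force
  qed
qed (metis flinear_zero fs.subspace_0 inj_onD)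

text \<open>Gaussian elimination: a pivot \<open>p\<close> of one equation is used to remove one unknown and one equation.\<close>

lemma underdetermined_matrix:
  fixes a :: "'j \<Rightarrow> 'i \<Rightarrow> 'k::field"
  assumes "finite J" "finite I" "card J < card I"
  shows "\<exists>x. (\<exists>i\<in>I. x i \<noteq> 0) \<and> (\<forall>j\<in>J. (\<Sum>i\<in>I. a j i * x i) = 0)"
  using assms
proof (induction J arbitrary: I a rule: finite_induct)
  case empty
  then have "I \<noteq> {}" by auto
  then show ?case by (intro exI[of _ "\<lambda>_. 1"]) auto
next
  case (insert j J)
  show ?case
  proof (cases "\<forall>i\<in>I. a j i = 0")
    case True
    from insert obtain x where "\<exists>i\<in>I. x i \<noteq> 0" "\<forall>j\<in>J. (\<Sum>i\<in>I. a j i * x i) = 0"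
      by (metis Suc_lessD card_insert_disjoint)
    with True show ?thesis by (intro exI[of _ x]) auto
  next
    case False
    then obtain p where p: "p \<in> I" "a j p \<noteq> 0" by auto
    define I' where "I' = I - {p}"
    define b where "b k i = a k i - a j i / a j p * a k p" for k i
    have "card J < card I'" using insert p by (simp add: I'_def)
    then obtain x where x: "\<exists>i\<in>I'. x i \<noteq> 0" "\<forall>j\<in>J. (\<Sum>i\<in>I'. b j i * x i) = 0"
      using insert.IH[of I' b] insert.prems by (auto simp: I'_def)
    define t where "t = - (\<Sum>i\<in>I'. a j i * x i) / a j p"
    define y where "y = x(p := t)"
    have split: "(\<Sum>i\<in>I. a k i * y i) = a k p * t + (\<Sum>i\<in>I'. a k i * x i)" for k
    proof -
      have "(\<Sum>i\<in>I. a k i * y i) = a k p * y p + (\<Sum>i\<in>I'. a k i * y i)"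
        unfolding I'_def using insert.prems p by (simp add: sum.remove)
      also have "(\<Sum>i\<in>I'. a k i * y i) = (\<Sum>i\<in>I'. a k i * x i)"
        by (rule sum.cong) (auto simp: y_def I'_def)
      finally show ?thesis by (simp add: y_def)
    qed
    have "(\<Sum>i\<in>I. a k i * y i) = 0" if "k \<in> insert j J" for k
    proof (cases "k = j")
      case True
      then show ?thesis using split[of j] p by (simp add: t_def)
    next
      case False
      then have "k \<in> J" using that by simp
      then have "0 = (\<Sum>i\<in>I'. b k i * x i)" using x by simp
      also have "\<dots> = (\<Sum>i\<in>I'. a k i * x i - a j i * x i / a j p * a k p)"
        by (rule sum.cong) (simp_all add: b_def left_diff_distrib)
      also have "\<dots> = (\<Sum>i\<in>I'. a k i * x i) - (\<Sum>i\<in>I'. a j i * x i) / a j p * a k p"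
        by (simp add: sum_subtractf sum_divide_distrib sum_distrib_right)
      finally show ?thesis using split[of k] by (simp add: t_def)
    qed
    moreover have "\<exists>i\<in>I. y i \<noteq> 0" using x(1) by (auto simp: y_def I'_def)
    ultimately show ?thesis by blast
  qed
qed

lemma underdetermined:
  fixes L :: "'j \<Rightarrow> ('i \<Rightarrow> 'k::field) \<Rightarrow> 'k"
  assumes "finite J" "finite I" "card J < card I"
    and add: "\<And>j x y. j \<in> J \<Longrightarrow> L j (\<lambda>i. x i + y i) = L j x + L j y"
    and scale: "\<And>j c x. j \<in> J \<Longrightarrow> L j (\<lambda>i. c * x i) = c * L j x"
  obtains x where "\<exists>i\<in>I. x i \<noteq> 0" "\<forall>i. i \<notin> I \<longrightarrow> x i = 0" "\<forall>j\<in>J. L j x = 0"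
proof -
  define u where "u i = (\<lambda>k. if k = i then 1 else 0 :: 'k)" for i :: 'i
  obtain x where x: "\<exists>i\<in>I. x i \<noteq> 0" "\<forall>j\<in>J. (\<Sum>i\<in>I. L j (u i) * x i) = 0"
    using underdetermined_matrix[OF assms(1-3), of "\<lambda>j i. L j (u i)"] by blast
  have L: "L j (\<lambda>k. if k \<in> F then x k else 0) = (\<Sum>i\<in>F. L j (u i) * x i)"
    if "finite F" "j \<in> J" for F j
    using that(1)
  proof (induction F)
    case empty
    show ?case using scale[OF that(2), of 0 x] by simp
  next
    case (insert p F)
    have "(\<lambda>k. if k \<in> insert p F then x k else 0)
        = (\<lambda>k. x p * u p k + (if k \<in> F then x k else 0))"
      using insert.hyps by (auto simp: u_def)
    then show ?case using insert by (simp add: add[OF that(2)] scale[OF that(2)] mult.commute)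
  qed
  show thesis
    by (rule that[of "\<lambda>k. if k \<in> I then x k else 0"]) (use x L assms(2) in auto)
qed

section \<open>Modules, submodules and weights\<close>

lemma Bmodule_facts:
  assumes "Bmodule n M"
  shows vsp_fin: "i \<le> n \<Longrightarrow> fin_dim_subspace (vsp M i)"
    and vsp_sub: "i \<le> n \<Longrightarrow> fs.subspace (vsp M i)"
    and al_lin: "i < n \<Longrightarrow> flinear (al M i)"
    and be_lin: "i < n \<Longrightarrow> flinear (be M i)"
    and al_in: "i < n \<Longrightarrow> x \<in> vsp M (Suc i) \<Longrightarrow> al M i x \<in> vsp M i"
    and be_in: "i < n \<Longrightarrow> x \<in> vsp M i \<Longrightarrow> be M i x \<in> vsp M (Suc i)"
    and al_al: "Suc i < n \<Longrightarrow> x \<in> vsp M (Suc (Suc i)) \<Longrightarrow> al M i (al M (Suc i) x) = 0"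
    and be_be: "Suc i < n \<Longrightarrow> x \<in> vsp M i \<Longrightarrow> be M (Suc i) (be M i x) = 0"
    and be_al: "Suc i < n \<Longrightarrow> x \<in> vsp M (Suc i) \<Longrightarrow> be M i (al M i x) = al M (Suc i) (be M (Suc i) x)"
    and al_be_0: "x \<in> vsp M 0 \<Longrightarrow> al M 0 (be M 0 x) = 0"
proof -
  have rep: "representation n M" and rel: "satisfies_relations n M"
    using assms by (auto simp: Bmodule_def)
  show "i \<le> n \<Longrightarrow> fin_dim_subspace (vsp M i)" "i \<le> n \<Longrightarrow> fs.subspace (vsp M i)"
    "i < n \<Longrightarrow> flinear (al M i)" "i < n \<Longrightarrow> flinear (be M i)"
    "i < n \<Longrightarrow> x \<in> vsp M (Suc i) \<Longrightarrow> al M i x \<in> vsp M i"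
    "i < n \<Longrightarrow> x \<in> vsp M i \<Longrightarrow> be M i x \<in> vsp M (Suc i)"
    using rep by (auto simp: representation_def fin_dim_subspace_def image_subset_iff)
  show "Suc i < n \<Longrightarrow> x \<in> vsp M (Suc (Suc i)) \<Longrightarrow> al M i (al M (Suc i) x) = 0"
    "Suc i < n \<Longrightarrow> x \<in> vsp M i \<Longrightarrow> be M (Suc i) (be M i x) = 0"
    "Suc i < n \<Longrightarrow> x \<in> vsp M (Suc i) \<Longrightarrow> be M i (al M i x) = al M (Suc i) (be M (Suc i) x)"
    "x \<in> vsp M 0 \<Longrightarrow> al M 0 (be M 0 x) = 0"
    using rel[unfolded satisfies_relations_def, THEN conjunct1, rule_format, of i]
      rel[unfolded satisfies_relations_def, THEN conjunct2]
    by (simp_all add: Suc_le_eq)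
qed

lemma submodule_restrict_iff:
  "submodule n (M\<lparr>vsp := U\<rparr>) M \<longleftrightarrow>
     (\<forall>i\<le>n. fs.subspace (U i) \<and> U i \<subseteq> vsp M i) \<and>
     (\<forall>i<n. (\<forall>x\<in>U (Suc i). al M i x \<in> U i) \<and> (\<forall>x\<in>U i. be M i x \<in> U (Suc i)))"
  by (simp add: submodule_def image_subset_iff)

lemma submodule_Bmodule:
  assumes "Bmodule n M" "submodule n N M"
  shows "Bmodule n N"
proof -
  have sub: "\<And>i. i \<le> n \<Longrightarrow> vsp N i \<subseteq> vsp M i" and eq: "al N = al M" "be N = be M"
    using assms(2) by (auto simp: submodule_def)
  have "fin_dim_subspace (vsp N i)" if "i \<le> n" for i
    using fin_dim_subspace_subset[of "vsp M i" "vsp N i"] assms that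
    by (auto simp: submodule_def Bmodule_def representation_def)
  then have "representation n N"
    using assms by (auto simp: submodule_def Bmodule_def representation_def)
  moreover have "satisfies_relations n N"
  proof -
    have rel: "satisfies_relations n M" using assms(1) by (simp add: Bmodule_def)
    have sub': "\<And>i x. x \<in> vsp N i \<Longrightarrow> i \<le> n \<Longrightarrow> x \<in> vsp M i" using sub by blast
    show ?thesis
      unfolding satisfies_relations_def eq
    proof (intro conjI allI impI ballI)
      fix i x assume i: "i + 2 \<le> n"
      show "be M i (al M i x) = al M (i + 1) (be M (i + 1) x)" if "x \<in> vsp N (i + 1)"
        using rel i sub'[OF that] unfolding satisfies_relations_def by simp
      show "al M i (al M (i + 1) x) = 0" if "x \<in> vsp N (i + 2)"
        using rel i sub'[OF that] unfolding satisfies_relations_def by simp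
      show "be M (i + 1) (be M i x) = 0" if "x \<in> vsp N i"
        using rel i sub'[OF that] unfolding satisfies_relations_def by simp
    next
      fix x assume "x \<in> vsp N 0"
      then show "al M 0 (be M 0 x) = 0"
        using rel sub'[of x 0] unfolding satisfies_relations_def by simp
    qed
  qed
  ultimately show ?thesis by (simp add: Bmodule_def)
qed

lemma submodule_trans: "submodule n L N \<Longrightarrow> submodule n N M \<Longrightarrow> submodule n L M"
  by (simp add: submodule_def) (meson subset_trans)

lemma submodule_refl: "Bmodule n M \<Longrightarrow> submodule n M M"
  by (simp add: submodule_def Bmodule_def representation_def fin_dim_subspace_def)

text \<open>The scalar product of \<open>v\<close> with a dimension vector, indexed by vertices and taken of a family of
  subspaces, so that it can be evaluated on a candidate submodule given by its spaces alone.\<close>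

definition pairing :: "nat \<Rightarrow> (nat \<Rightarrow> real) \<Rightarrow> (nat \<Rightarrow> (nat \<Rightarrow> 'k::field) set) \<Rightarrow> real" where
  "pairing n v U = (\<Sum>i\<le>n. v (n - i) * real (fs.dim (U i)))"

lemma scalar_product_dimvec: "scalar_product n v (dimvec n M) = pairing n v (vsp M)"
proof -
  have "scalar_product n v (dimvec n M) = (\<Sum>j\<le>n. v j * real (fs.dim (vsp M (n - j))))"
    by (simp add: scalar_product_def dimvec_def)
  also have "\<dots> = (\<Sum>j\<le>n. v (n - j) * real (fs.dim (vsp M j)))"
    by (rule sum.reindex_bij_witness[of _ "\<lambda>i. n - i" "\<lambda>i. n - i"]) auto
  finally show ?thesis by (simp add: pairing_def)
qed

lemma pairing_cong: "(\<And>i. i \<le> n \<Longrightarrow> fs.dim (U i) = fs.dim (W i)) \<Longrightarrow> pairing n v U = pairing n v W"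
  by (simp add: pairing_def)

lemma pairing_interval:
  assumes "e \<le> n" "\<And>i. i \<le> n \<Longrightarrow> \<not> (c \<le> i \<and> i \<le> e) \<Longrightarrow> fs.dim (U i) = 0"
  shows "pairing n v U = (\<Sum>i=c..e. v (n - i) * real (fs.dim (U i)))"
  unfolding pairing_def
proof (rule sum.mono_neutral_right)
  show "\<forall>i\<in>{..n} - {c..e}. v (n - i) * real (fs.dim (U i)) = 0"
    using assms(2) by simp
qed (use assms(1) in auto)

lemma semistable_submodule_le:
  assumes "semistable n v M" "submodule n N M"
  shows "pairing n v (vsp N) \<le> 0"
proof (cases "proper_submodule n N M")
  case False
  then have "\<And>i. i \<le> n \<Longrightarrow> vsp N i = vsp M i" using assms(2) by (auto simp: proper_submodule_def)
  then have "pairing n v (vsp N) = pairing n v (vsp M)" by (intro pairing_cong) simp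
  then show ?thesis using assms(1) by (simp add: semistable_def scalar_product_dimvec)
next
  case True
  show ?thesis
  proof (cases "zero_rep n N")
    case True
    then show ?thesis by (simp add: zero_rep_def pairing_def)
  next
    case False
    then show ?thesis using assms(1) True by (simp add: semistable_def scalar_product_dimvec)
  qed
qed

lemma semistable_pairing_eq: "semistable n v M \<Longrightarrow> pairing n v (vsp M) = 0"
  by (simp add: semistable_def scalar_product_dimvec)

text \<open>If \<open>\<beta>\<^sub>q\<close> acts by zero, nothing leaves the vertices \<open>0..q\<close> to the right.\<close>

lemma lower_cut_submodule:
  assumes M: "Bmodule n M" and q: "q < n" "\<forall>x\<in>vsp M q. be M q x = 0"
  shows "submodule n (M\<lparr>vsp := (\<lambda>i. if i \<le> q then vsp M i else {0})\<rparr>) M"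
proof -
  have "be M i x \<in> (if Suc i \<le> q then vsp M (Suc i) else {0})"
    if "i < n" "x \<in> (if i \<le> q then vsp M i else {0})" for i x
    using that q be_in[OF M, of i x] flinear_zero[OF be_lin[OF M, of i]]
    by (cases "i = q") (auto split: if_splits)
  moreover have "al M i x \<in> (if i \<le> q then vsp M i else {0})"
    if "i < n" "x \<in> (if Suc i \<le> q then vsp M (Suc i) else {0})" for i x
    using that al_in[OF M, of i x] flinear_zero[OF al_lin[OF M, of i]] fs.subspace_0[OF vsp_sub[OF M, of i]]
    by (auto split: if_splits)
  ultimately show ?thesis
    unfolding submodule_restrict_iff using vsp_sub[OF M] by (auto simp: fs.subspace_0)
qed

lemma upper_cut_submodule:
  assumes M: "Bmodule n M" and q: "q < n" "\<forall>x\<in>vsp M (Suc q). al M q x = 0"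
  shows "submodule n (M\<lparr>vsp := (\<lambda>i. if q < i then vsp M i else {0})\<rparr>) M"
proof -
  have "al M i x \<in> (if q < i then vsp M i else {0})"
    if "i < n" "x \<in> (if q < Suc i then vsp M (Suc i) else {0})" for i x
    using that q al_in[OF M, of i x] flinear_zero[OF al_lin[OF M, of i]]
    by (cases "i = q") (auto split: if_splits)
  moreover have "be M i x \<in> (if q < Suc i then vsp M (Suc i) else {0})"
    if "i < n" "x \<in> (if q < i then vsp M i else {0})" for i x
    using that be_in[OF M, of i x] flinear_zero[OF be_lin[OF M, of i]]
      fs.subspace_0[OF vsp_sub[OF M, of "Suc i"]]
    by (auto split: if_splits)
  ultimately show ?thesis
    unfolding submodule_restrict_iff using vsp_sub[OF M] by (auto simp: fs.subspace_0)
qed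

section \<open>Zigzags and their stability spaces\<close>

text \<open>The two possible shapes of a zigzag between the vertices \<open>q\<close> and \<open>q + 1\<close>.\<close>

definition gap_down :: "'k::field rep \<Rightarrow> nat \<Rightarrow> bool" where
  "gap_down M q \<longleftrightarrow> bij_betw (al M q) (vsp M (Suc q)) (vsp M q) \<and> (\<forall>x\<in>vsp M q. be M q x = 0)"

definition gap_up :: "'k::field rep \<Rightarrow> nat \<Rightarrow> bool" where
  "gap_up M q \<longleftrightarrow> bij_betw (be M q) (vsp M q) (vsp M (Suc q)) \<and> (\<forall>x\<in>vsp M (Suc q). al M q x = 0)"

definition interval_dims :: "nat \<Rightarrow> nat \<Rightarrow> nat \<Rightarrow> nat \<Rightarrow> 'k::field rep \<Rightarrow> bool" where
  "interval_dims n c e m M \<longleftrightarrow>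
     c \<le> e \<and> e \<le> n \<and> 0 < m \<and> (\<forall>i\<le>n. fs.dim (vsp M i) = (if c \<le> i \<and> i \<le> e then m else 0))"

text \<open>The boolean \<open>p\<close> records which of the two alternating patterns occurs: \<open>\<alpha>\<^sub>q\<close> is the bijective arrow
  at the \<open>q\<close> of one parity, \<open>\<beta>\<^sub>q\<close> at the \<open>q\<close> of the other parity.\<close>

definition zigzag :: "nat \<Rightarrow> nat \<Rightarrow> nat \<Rightarrow> bool \<Rightarrow> nat \<Rightarrow> 'k::field rep \<Rightarrow> bool" where
  "zigzag n c e p m M \<longleftrightarrow> interval_dims n c e m M \<and>
     (\<forall>q. c \<le> q \<and> q < e \<longrightarrow> (if even q = p then gap_down M q else gap_up M q))"

definition zigzag_cone :: "nat \<Rightarrow> nat \<Rightarrow> nat \<Rightarrow> bool \<Rightarrow> (nat \<Rightarrow> real) set" where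
  "zigzag_cone n c e p = {v \<in> topspace (Euclidean_space (n + 1)).
     (\<Sum>i=c..e. v (n - i)) = 0 \<and>
     (\<forall>q. c \<le> q \<and> q < e \<longrightarrow>
        (if even q = p then (\<Sum>i=c..q. v (n - i)) \<le> 0 else 0 \<le> (\<Sum>i=c..q. v (n - i))))}"

lemma nonzero_vector:
  assumes "Bmodule n M" "i \<le> n" "fs.dim (vsp M i) > 0"
  obtains x where "x \<in> vsp M i" "x \<noteq> 0"
proof -
  have "vsp M i \<noteq> {0}" using assms(3) dim_zero_space by (metis less_irrefl)
  moreover have "0 \<in> vsp M i" using vsp_sub[OF assms(1,2)] fs.subspace_0 by blast
  ultimately show thesis using that by blast
qed

lemma gap_down_inj: "gap_down M q \<Longrightarrow> Bmodule n M \<Longrightarrow> q < n \<Longrightarrow> x \<in> vsp M (Suc q) \<Longrightarrow> al M q x = 0 \<Longrightarrow> x = 0"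
  unfolding gap_down_def bij_betw_def
  by (metis al_lin inj_on_ker Suc_leI vsp_sub)

lemma gap_up_inj: "gap_up M q \<Longrightarrow> Bmodule n M \<Longrightarrow> q < n \<Longrightarrow> x \<in> vsp M q \<Longrightarrow> be M q x = 0 \<Longrightarrow> x = 0"
  unfolding gap_up_def bij_betw_def
  by (metis be_lin inj_on_ker less_imp_le vsp_sub)

text \<open>Two consecutive gaps with injective \<open>\<alpha>\<^sub>q\<close> and \<open>\<alpha>\<^bsub>q+1\<^esub>\<close>, or with injective \<open>\<beta>\<^sub>q\<close> and \<open>\<beta>\<^bsub>q+1\<^esub>\<close>, would
  contradict \<open>\<alpha>\<alpha> = 0\<close> or \<open>\<beta>\<beta> = 0\<close>. So the directions of the bijective arrows alternate.\<close>

lemma gaps_alternate: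
  assumes M: "Bmodule n M" and d: "interval_dims n c e m M"
    and g: "\<And>q. c \<le> q \<Longrightarrow> q < e \<Longrightarrow> gap_down M q \<or> gap_up M q"
  obtains p where "zigzag n c e p m M"
proof -
  have e: "e \<le> n" using d by (simp add: interval_dims_def)
  have dpos: "fs.dim (vsp M i) > 0" if "c \<le> i" "i \<le> e" for i
    using d that by (auto simp: interval_dims_def)
  have excl: "\<not> (gap_down M q \<and> gap_up M q)" if q: "c \<le> q" "q < e" for q
  proof
    assume a: "gap_down M q \<and> gap_up M q"
    obtain x where "x \<in> vsp M q" "x \<noteq> 0" using dpos[of q] q e by (metis nonzero_vector[OF M, of q] less_imp_le le_trans le_SucI Suc_leD Suc_leI order_refl)
    then show False using a gap_up_inj[OF _ M, of q x] q e by (auto simp: gap_down_def)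
  qed
  have alt: "gap_down M (Suc q) \<longleftrightarrow> \<not> gap_down M q" if q: "c \<le> q" "Suc q < e" for q
  proof
    assume a: "gap_down M (Suc q)"
    show "\<not> gap_down M q"
    proof
      assume b: "gap_down M q"
      obtain x where x: "x \<in> vsp M (Suc (Suc q))" "x \<noteq> 0"
        using dpos[of "Suc (Suc q)"] q e by (metis nonzero_vector[OF M, of "Suc (Suc q)"] less_imp_le le_trans le_SucI Suc_leD Suc_leI order_refl)
      then show False
        using gap_down_inj[OF a M _ x(1)] gap_down_inj[OF b M, of "al M (Suc q) x"]
          al_al[OF M _ x(1)] al_in[OF M _ x(1)] q e by auto
    qed
  next
    assume "\<not> gap_down M q"
    then have b: "gap_up M q" using g[of q] q by auto
    have "\<not> gap_up M (Suc q)"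
    proof
      assume a: "gap_up M (Suc q)"
      obtain x where x: "x \<in> vsp M q" "x \<noteq> 0"
        using dpos[of q] q e by (metis nonzero_vector[OF M, of q] less_imp_le le_trans le_SucI Suc_leD Suc_leI order_refl)
      then show False
        using gap_up_inj[OF b M _ x(1)] gap_up_inj[OF a M, of "be M q x"]
          be_be[OF M _ x(1)] be_in[OF M _ x(1)] q e by auto
    qed
    then show "gap_down M (Suc q)" using g[of "Suc q"] q by auto
  qed
  define p where "p \<longleftrightarrow> (even c \<longleftrightarrow> gap_down M c)"
  have "gap_down M q \<longleftrightarrow> (even q = p)" if "c \<le> q" "q < e" for q
    using that
  proof (induction q rule: dec_induct)
    case base
    then show ?case by (auto simp: p_def)
  next
    case (step q)
    then show ?case using alt[of q] by auto
  qed
  then have "zigzag n c e p m M"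
    using d g by (auto simp: zigzag_def)
  then show thesis using that by blast
qed

text \<open>Summation by parts. Since the total weight is \<open>0\<close>, the pairing of \<open>w\<close> with \<open>u\<close> is minus the sum of
  the products of the weight of an initial segment with the next increment of \<open>u\<close>.\<close>

lemma zigzag_pairing_le:
  fixes w :: "nat \<Rightarrow> real" and u :: "nat \<Rightarrow> real"
  assumes "c \<le> e" and total: "(\<Sum>i=c..e. w i) = 0"
    and step: "\<And>q. c \<le> q \<Longrightarrow> q < e \<Longrightarrow> 0 \<le> (\<Sum>i=c..q. w i) * (u (Suc q) - u q)"
  shows "(\<Sum>i=c..e. w i * u i) \<le> 0"
proof -
  have "k \<le> e \<Longrightarrow> (\<Sum>i=c..k. w i * u i) \<le> (\<Sum>i=c..k. w i) * u k" if "c \<le> k" for k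
    using that
  proof (induction k rule: dec_induct)
    case (step q)
    have "(\<Sum>i=c..Suc q. w i * u i) \<le> (\<Sum>i=c..q. w i) * u q + w (Suc q) * u (Suc q)"
      using step by simp
    also have "\<dots> \<le> (\<Sum>i=c..q. w i) * u (Suc q) + w (Suc q) * u (Suc q)"
      using assms(3)[of q] step by (simp add: right_diff_distrib)
    also have "\<dots> = (\<Sum>i=c..Suc q. w i) * u (Suc q)"
      using step by (simp add: distrib_right)
    finally show ?case .
  qed simp
  from this[of e] show ?thesis using assms(1) total by simp
qed

text \<open>At every gap, the part of \<open>M\<close> on the side of the target of the non-zero arrow is a submodule,
  which gives the inequalities of the cone. Conversely, along a bijective arrow the dimensions of a submodule can only
  increase, and this is what summation by parts needs to bound the weight of the submodule. The
  weight of each of the former submodules is \<open>m\<close> times the weight of a segment, so the cone does not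
  depend on \<open>m\<close>.\<close>

lemma stability_space_zigzag:
  assumes M: "Bmodule n M" and z: "zigzag n c e p m M"
  shows "stability_space n M = zigzag_cone n c e p"
proof -
  have d: "c \<le> e" "e \<le> n" "0 < m" "\<And>i. i \<le> n \<Longrightarrow> fs.dim (vsp M i) = (if c \<le> i \<and> i \<le> e then m else 0)"
    using z by (auto simp: zigzag_def interval_dims_def)
  have gap: "if even q = p then gap_down M q else gap_up M q" if "c \<le> q" "q < e" for q
    using z that by (auto simp: zigzag_def)
  have tot: "pairing n v (vsp M) = real m * (\<Sum>i=c..e. v (n - i))" for v
  proof -
    have "pairing n v (vsp M) = (\<Sum>i=c..e. v (n - i) * real (fs.dim (vsp M i)))"
      using d by (intro pairing_interval) auto
    also have "\<dots> = (\<Sum>i=c..e. v (n - i) * real m)" using d by (intro sum.cong) auto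
    finally show ?thesis by (simp add: sum_distrib_left mult.commute)
  qed
  have "semistable n v M \<longleftrightarrow> (\<Sum>i=c..e. v (n - i)) = 0 \<and> (\<forall>q. c \<le> q \<and> q < e \<longrightarrow>
        (if even q = p then (\<Sum>i=c..q. v (n - i)) \<le> 0 else 0 \<le> (\<Sum>i=c..q. v (n - i))))"
    (is "_ \<longleftrightarrow> ?R") for v
  proof
    assume ss: "semistable n v M"
    have s0: "(\<Sum>i=c..e. v (n - i)) = 0"
      using semistable_pairing_eq[OF ss] tot[of v] d(3) by simp
    moreover have "if even q = p then (\<Sum>i=c..q. v (n - i)) \<le> 0 else 0 \<le> (\<Sum>i=c..q. v (n - i))"
      if q: "c \<le> q" "q < e" for q
    proof (cases "even q = p")
      case True
      let ?U = "\<lambda>i. if i \<le> q then vsp M i else {0}"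
      have "gap_down M q" using gap[OF q] True by simp
      then have "submodule n (M\<lparr>vsp := ?U\<rparr>) M"
        using q d(2) by (intro lower_cut_submodule[OF M]) (auto simp: gap_down_def)
      then have "pairing n v ?U \<le> 0" using semistable_submodule_le[OF ss] by fastforce
      also have "pairing n v ?U = (\<Sum>i=c..q. v (n - i) * real (fs.dim (?U i)))"
        using d q by (intro pairing_interval) auto
      also have "\<dots> = (\<Sum>i=c..q. v (n - i) * real m)" using d q by (intro sum.cong) auto
      finally show ?thesis using True d(3) by (simp add: sum_distrib_right[symmetric] mult_le_0_iff)
    next
      case False
      let ?U = "\<lambda>i. if q < i then vsp M i else {0}"
      have "gap_up M q" using gap[OF q] False by simp
      then have "submodule n (M\<lparr>vsp := ?U\<rparr>) M"
        using q d(2) by (intro upper_cut_submodule[OF M]) (auto simp: gap_up_def)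
      then have "pairing n v ?U \<le> 0" using semistable_submodule_le[OF ss] by fastforce
      also have "pairing n v ?U = (\<Sum>i=Suc q..e. v (n - i) * real (fs.dim (?U i)))"
        by (rule pairing_interval[OF d(2)]) (use d(4) q in auto)
      also have "\<dots> = (\<Sum>i=Suc q..e. v (n - i) * real m)"
        by (rule sum.cong) (use d q in auto)
      finally have "(\<Sum>i=Suc q..e. v (n - i)) \<le> 0"
        using d(3) by (simp add: sum_distrib_right[symmetric] mult_le_0_iff)
      moreover have "(\<Sum>i=c..e. v (n - i)) = (\<Sum>i=c..q. v (n - i)) + (\<Sum>i=Suc q..e. v (n - i))"
        using sum.ub_add_nat[of c q "\<lambda>i. v (n - i)" "e - q"] q
        by (simp del: sum.cl_ivl_Suc)
      ultimately show ?thesis using False s0 by simp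
    qed
    ultimately show ?R by blast
  next
    assume R: ?R
    have "pairing n v (vsp N) \<le> 0" if N: "submodule n N M" for N
    proof -
      have BN: "Bmodule n N" by (rule submodule_Bmodule[OF M N])
      have eq: "al N = al M" "be N = be M" using N by (auto simp: submodule_def)
      have NM: "vsp N i \<subseteq> vsp M i" if "i \<le> n" for i using N that by (auto simp: submodule_def)
      have le: "fs.dim (vsp N i) \<le> fs.dim (vsp M i)" if "i \<le> n" for i
        using dim_mono_fin[OF vsp_fin[OF M that] vsp_sub[OF BN that] NM[OF that]] .
      have "(\<Sum>i=c..e. v (n - i) * real (fs.dim (vsp N i))) \<le> 0"
      proof (rule zigzag_pairing_le)
        fix q assume q: "c \<le> q" "q < e"
        show "0 \<le> (\<Sum>i=c..q. v (n - i)) * (real (fs.dim (vsp N (Suc q))) - real (fs.dim (vsp N q)))"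
        proof (cases "even q = p")
          case True
          then have g: "gap_down M q" using gap[OF q] by simp
          have "fs.dim (vsp N (Suc q)) = fs.dim (al N q ` vsp N (Suc q))"
            using gap_down_inj[OF g M] NM[of "Suc q"] q d(2) eq
            by (intro dim_image_inj[OF al_lin[OF BN] vsp_fin[OF BN], symmetric]) auto
          also have "\<dots> \<le> fs.dim (vsp N q)"
            using q d(2) al_in[OF BN]
            by (intro dim_mono_fin[OF vsp_fin[OF BN] subspace_img[OF al_lin[OF BN] vsp_sub[OF BN]]]) auto
          finally have "real (fs.dim (vsp N (Suc q))) - real (fs.dim (vsp N q)) \<le> 0" by simp
          moreover have "(\<Sum>i=c..q. v (n - i)) \<le> 0" using R True q by metis
          ultimately show ?thesis by (rule mult_nonpos_nonpos[rotated])
        next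
          case False
          then have g: "gap_up M q" using gap[OF q] by simp
          have "fs.dim (vsp N q) = fs.dim (be N q ` vsp N q)"
            using gap_up_inj[OF g M] NM[of q] q d(2) eq
            by (intro dim_image_inj[OF be_lin[OF BN] vsp_fin[OF BN], symmetric]) auto
          also have "\<dots> \<le> fs.dim (vsp N (Suc q))"
            using q d(2) be_in[OF BN]
            by (intro dim_mono_fin[OF vsp_fin[OF BN] subspace_img[OF be_lin[OF BN] vsp_sub[OF BN]]]) auto
          finally have "0 \<le> real (fs.dim (vsp N (Suc q))) - real (fs.dim (vsp N q))" by simp
          moreover have "0 \<le> (\<Sum>i=c..q. v (n - i))" using R False q by metis
          ultimately show ?thesis by (rule mult_nonneg_nonneg[rotated])
        qed
      qed (use R d(1) in blast)+
      also have "(\<Sum>i=c..e. v (n - i) * real (fs.dim (vsp N i))) = pairing n v (vsp N)"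
      proof (rule pairing_interval[symmetric])
        fix i assume "i \<le> n" "\<not> (c \<le> i \<and> i \<le> e)"
        then show "fs.dim (vsp N i) = 0" using le[of i] d(4)[of i] by auto
      qed (rule d)
      finally show ?thesis .
    qed
    moreover have "pairing n v (vsp M) = 0" using R tot[of v] by simp
    ultimately show "semistable n v M"
      by (auto simp: semistable_def scalar_product_dimvec proper_submodule_def)
  qed
  then show ?thesis by (auto simp: stability_space_def zigzag_cone_def)
qed

section \<open>Zigzags of multiplicity one are thin indecomposables\<close>

text \<open>The line of constant sequences serves as the one-dimensional space at every vertex of the interval,
  so that the bijective arrows can be identities.\<close>

definition zigzag_rep :: "nat \<Rightarrow> nat \<Rightarrow> bool \<Rightarrow> 'k::field rep" where
  "zigzag_rep c e p = \<lparr>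
     vsp = (\<lambda>i. if c \<le> i \<and> i \<le> e then fs.span {\<lambda>_. 1} else {0}),
     al = (\<lambda>q x. if c \<le> q \<and> q < e \<and> even q = p then x else 0),
     be = (\<lambda>q x. if c \<le> q \<and> q < e \<and> even q \<noteq> p then x else 0)\<rparr>"

lemma flinear_if: "flinear (\<lambda>x. if P then x else 0)"
  by (cases P) (simp_all add: fs.linear_ident fsp.linear_0 fsp.linear_zero)

lemma fin_dim_subspace_span: "finite B \<Longrightarrow> fin_dim_subspace (fs.span B)"
  unfolding fin_dim_subspace_def by auto

lemma Bmodule_zigzag_rep: "Bmodule n (zigzag_rep c e p)"
  unfolding Bmodule_def representation_def satisfies_relations_def zigzag_rep_def
  using fin_dim_subspace_span[of "{\<lambda>_. 1}"] fin_dim_subspace_span[of "{}"]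
  by (auto simp: flinear_if fs.span_zero)

lemma zigzag_zigzag_rep:
  assumes "c \<le> e" "e \<le> n"
  shows "zigzag n c e p 1 (zigzag_rep c e p :: 'k::field rep)"
proof -
  have "fs.dim (fs.span {\<lambda>_. 1 :: 'k}) = 1"
  proof -
    have "fs.independent {\<lambda>_. 1 :: 'k}" by (simp add: fun_eq_iff)
    then show ?thesis using fs.dim_span_eq_card_independent by fastforce
  qed
  then show ?thesis
    using assms
    by (auto simp: zigzag_def interval_dims_def gap_down_def gap_up_def zigzag_rep_def
        bij_betw_def inj_on_def)
qed

lemma sums_commute:
  fixes A B :: "'a::ab_semigroup_add set"
  shows "{x + y | x y. x \<in> A \<and> y \<in> B} = {x + y | x y. x \<in> B \<and> y \<in> A}"
  by (auto; metis add.commute)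

text \<open>In a decomposition \<open>N \<oplus> L\<close>, one of the summands vanishes at the vertex \<open>c\<close>, where \<open>M\<close> has dimension
  one. If \<open>L\<close> vanishes at one end of a bijective arrow, it vanishes at the other end as well: either
  the arrow embeds \<open>L\<close> into a zero space, or it maps the full space \<open>N\<close> onto everything.\<close>

lemma zigzag_indecomposable:
  assumes M: "Bmodule n M" and z: "zigzag n c e p 1 M"
  shows "indecomposable n M"
  unfolding indecomposable_def
proof (intro conjI allI impI)
  have d: "c \<le> e" "e \<le> n" "\<And>i. i \<le> n \<Longrightarrow> fs.dim (vsp M i) = (if c \<le> i \<and> i \<le> e then 1 else 0)"
    using z by (auto simp: zigzag_def interval_dims_def)
  have gap: "gap_down M q \<or> gap_up M q" if "c \<le> q" "q < e" for q
    using z that by (auto simp: zigzag_def split: if_splits)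
  have dc: "fs.dim (vsp M c) = 1" using d by auto
  show "\<not> zero_rep n M"
  proof
    assume "zero_rep n M"
    then have "vsp M c = {0}" using d by (simp add: zero_rep_def)
    then show False using dc dim_zero_space by (metis zero_neq_one)
  qed
  have vanish: "zero_rep n L"
    if N: "submodule n N M" and L: "submodule n L M"
      and int: "\<And>i. i \<le> n \<Longrightarrow> vsp N i \<inter> vsp L i = {0}"
      and sum: "\<And>i. i \<le> n \<Longrightarrow> {x + y | x y. x \<in> vsp N i \<and> y \<in> vsp L i} = vsp M i"
      and Lc: "vsp L c = {0}" for N L
  proof -
    have eq: "al L = al M" "be L = be M" "al N = al M" "be N = be M"
      using N L by (auto simp: submodule_def)
    have BL: "Bmodule n L" and BN: "Bmodule n N" using submodule_Bmodule M N L by blast+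
    have LM: "x \<in> vsp L i \<Longrightarrow> i \<le> n \<Longrightarrow> x \<in> vsp M i" for x i using L by (auto simp: submodule_def)
    have "k \<le> e \<Longrightarrow> vsp L k = {0}" if "c \<le> k" for k
      using that
    proof (induction k rule: dec_induct)
      case base
      show ?case by (rule Lc)
    next
      case (step q)
      then have q: "c \<le> q" "q < e" "q < n" using d by auto
      have Lq: "vsp L q = {0}" using step.IH less_imp_le[OF q(2)] by blast
      have "x = 0" if x: "x \<in> vsp L (Suc q)" for x
      proof -
        have xM: "x \<in> vsp M (Suc q)" using LM[OF x] q by simp
        show ?thesis using gap[OF q(1,2)]
        proof
          assume g: "gap_down M q"
          have "al M q x \<in> vsp L q" using al_in[OF BL q(3) x] eq by simp
          then show ?thesis using gap_down_inj[OF g M q(3) xM] Lq by simp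
        next
          assume g: "gap_up M q"
          obtain y where y: "y \<in> vsp M q" "x = be M q y"
            using g xM by (auto simp: gap_up_def bij_betw_def)
          have "y \<in> vsp N q" using sum[of q] y(1) Lq q by auto
          then have "x \<in> vsp N (Suc q)" using be_in[OF BN q(3)] y eq by simp
          then show ?thesis using int[of "Suc q"] x Suc_leI[OF q(3)] by blast
        qed
      qed
      then show ?case using fs.subspace_0[OF vsp_sub[OF BL, of "Suc q"]] Suc_leI[OF q(3)] by blast
    qed
    moreover have "vsp L i = {0}" if "i \<le> n" "\<not> (c \<le> i \<and> i \<le> e)" for i
    proof -
      have "vsp M i = {0}" using d(3)[OF that(1)] that(2) dim_eq_0_iff[OF vsp_fin[OF M that(1)]] by auto
      then show ?thesis using LM[of _ i] that(1) fs.subspace_0[OF vsp_sub[OF BL that(1)]] by blast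
    qed
    ultimately show ?thesis unfolding zero_rep_def by blast
  qed
  fix N L assume a: "submodule n N M \<and> submodule n L M \<and>
        (\<forall>i\<le>n. vsp N i \<inter> vsp L i = {0} \<and> {x + y | x y. x \<in> vsp N i \<and> y \<in> vsp L i} = vsp M i)"
  note N = a[THEN conjunct1] and L = a[THEN conjunct2, THEN conjunct1]
    and int = a[THEN conjunct2, THEN conjunct2, rule_format, THEN conjunct1]
    and sum = a[THEN conjunct2, THEN conjunct2, rule_format, THEN conjunct2]
  have int': "\<And>i. i \<le> n \<Longrightarrow> vsp L i \<inter> vsp N i = {0}" using int by blast
  have sum': "{x + y | x y. x \<in> vsp L i \<and> y \<in> vsp N i} = vsp M i" if "i \<le> n" for i using sums_commute sum[OF that] by (rule trans)
  have cn: "c \<le> n" using d by simp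
  have sN: "fs.subspace (vsp N c)" "vsp N c \<subseteq> vsp M c" using N cn by (auto simp: submodule_def)
  have fN: "fin_dim_subspace (vsp N c)" by (rule fin_dim_subspace_subset[OF vsp_fin[OF M cn] sN])
  show "zero_rep n N \<or> zero_rep n L"
  proof (cases "vsp N c = {0}")
    case True
    then show ?thesis using vanish[OF L N int' sum'] by blast
  next
    case False
    then have "fs.dim (vsp N c) \<noteq> 0" using dim_eq_0_iff[OF fN] by blast
    then have "fs.dim (vsp N c) = fs.dim (vsp M c)"
      using dim_mono_fin[OF vsp_fin[OF M cn] sN] dc by linarith
    then have "vsp N c = vsp M c" by (rule dim_eq_fin[OF vsp_fin[OF M cn] sN])
    moreover have "vsp L c \<subseteq> vsp M c" using L cn by (auto simp: submodule_def)
    ultimately have "vsp L c = {0}" using int[OF cn] by blast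
    then show ?thesis using vanish[OF N L int sum] by blast
  qed
qed

lemma iso_dim_eq:
  assumes "Bmodule n M" "iso n M N" "i \<le> n"
  shows "fs.dim (vsp M i) = fs.dim (vsp N i)"
proof -
  obtain f where f: "flinear (f i)" "bij_betw (f i) (vsp M i) (vsp N i)"
    using assms by (auto simp: iso_def hom_def)
  then have "fs.dim (f i ` vsp M i) = fs.dim (vsp M i)"
    using inj_on_ker[OF f(1) vsp_sub[OF assms(1,3)]]
    by (intro dim_image_inj[OF f(1) vsp_fin[OF assms(1,3)]]) (auto simp: bij_betw_def)
  then show ?thesis using f(2) by (simp add: bij_betw_def)
qed

lemma quotient_dim:
  assumes "Bmodule n N" "is_quotient n S N L" "i \<le> n"
  shows "fs.dim (vsp N i) = fs.dim (vsp S i) + fs.dim (vsp L i)"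
proof -
  obtain f where "flinear (f i)" "f i ` vsp N i = vsp S i" "{x \<in> vsp N i. f i x = 0} = vsp L i"
    using assms by (auto simp: is_quotient_def hom_def)
  then show ?thesis using rank_nullity[of "f i", OF _ vsp_fin[OF assms(1,3)]] by simp
qed

text \<open>Dimensions add up along a composition series. Two isomorphic factors would contribute at least \<open>2\<close>
  to the dimension at a vertex in their support.\<close>

lemma thin_if_dims_le_1:
  assumes M: "Bmodule n M" and d: "\<And>i. i \<le> n \<Longrightarrow> fs.dim (vsp M i) \<le> 1"
  shows "thin n M"
  unfolding thin_def
proof (intro allI impI notI)
  fix S j k assume cf: "composition_factors n M S" and jk: "j < k \<and> k < length S"
    and iso: "iso n (S ! j) (S ! k)"
  obtain U where U: "\<And>j. j \<le> length S \<Longrightarrow> submodule n (U j) M" "zero_rep n (U 0)"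
    "\<And>i. i \<le> n \<Longrightarrow> vsp (U (length S)) i = vsp M i"
    "\<And>j. j < length S \<Longrightarrow> simple_rep n (S ! j) \<and> is_quotient n (S ! j) (U (Suc j)) (U j)"
    using cf unfolding composition_factors_def by blast
  have dU: "r \<le> length S \<Longrightarrow> fs.dim (vsp (U r) i) = (\<Sum>l<r. fs.dim (vsp (S ! l) i))" if i: "i \<le> n" for i r
  proof (induction r)
    case 0
    then show ?case using U(2) i by (simp add: zero_rep_def)
  next
    case (Suc r)
    have "Bmodule n (U (Suc r))" using submodule_Bmodule[OF M U(1)] Suc by simp
    then show ?case using quotient_dim[of n "U (Suc r)" "S ! r" "U r" i] U(4)[of r] Suc i by simp
  qed
  have Bj: "Bmodule n (S ! j)" using U(4)[of j] jk by (simp add: is_quotient_def)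
  obtain i where i: "i \<le> n" "vsp (S ! j) i \<noteq> {0}"
    using U(4)[of j] jk by (auto simp: simple_rep_def zero_rep_def)
  have "fs.dim (vsp (S ! j) i) \<noteq> 0" using dim_eq_0_iff[OF vsp_fin[OF Bj i(1)]] i(2) by blast
  moreover have "fs.dim (vsp (S ! j) i) = fs.dim (vsp (S ! k) i)" by (rule iso_dim_eq[OF Bj iso i(1)])
  moreover have "(\<Sum>l\<in>{j, k}. fs.dim (vsp (S ! l) i)) \<le> (\<Sum>l<length S. fs.dim (vsp (S ! l) i))"
    by (rule sum_mono2) (use jk in auto)
  moreover have "(\<Sum>l\<in>{j, k}. fs.dim (vsp (S ! l) i)) = fs.dim (vsp (S ! j) i) + fs.dim (vsp (S ! k) i)"
    using jk by simp
  moreover have "(\<Sum>l<length S. fs.dim (vsp (S ! l) i)) \<le> 1"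
    using dU[OF i(1), of "length S"] U(3)[OF i(1)] d[OF i(1)] by simp
  ultimately show False by linarith
qed

lemma zigzag_rep_thin_indecomposable:
  assumes "c \<le> e" "e \<le> n"
  shows "(zigzag_rep c e p :: 'k::field rep) \<in> thin_indecomposables n"
proof -
  let ?T = "zigzag_rep c e p :: 'k rep"
  have z: "zigzag n c e p 1 ?T" by (rule zigzag_zigzag_rep[OF assms])
  have B: "Bmodule n ?T" by (rule Bmodule_zigzag_rep)
  have "fs.dim (vsp ?T i) \<le> 1" if "i \<le> n" for i
    using z that unfolding zigzag_def interval_dims_def by simp
  then have "thin n ?T" by (rule thin_if_dims_le_1[OF B])
  then show ?thesis
    using zigzag_indecomposable[OF B z] B by (simp add: thin_indecomposables_def indecomposables_def)
qed

lemma stability_space_zigzag_rep: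
  assumes "c \<le> e" "e \<le> n"
  shows "stability_space n (zigzag_rep c e p :: 'k::field rep) = zigzag_cone n c e p"
  by (rule stability_space_zigzag[OF Bmodule_zigzag_rep zigzag_zigzag_rep[OF assms]])

section \<open>Stable modules have radical square zero\<close>

definition stable :: "nat \<Rightarrow> (nat \<Rightarrow> real) \<Rightarrow> 'k::field rep \<Rightarrow> bool" where
  "stable n v N \<longleftrightarrow> Bmodule n N \<and> \<not> zero_rep n N \<and> pairing n v (vsp N) = 0 \<and>
     (\<forall>L. proper_submodule n L N \<and> \<not> zero_rep n L \<longrightarrow> pairing n v (vsp L) < 0)"

lemma proper_submodule_dim_less:
  assumes M: "Bmodule n M" and N: "proper_submodule n N M"
  shows "(\<Sum>i\<le>n. fs.dim (vsp N i)) < (\<Sum>i\<le>n. fs.dim (vsp M i))"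
proof -
  have sub: "fs.subspace (vsp N i)" "vsp N i \<subseteq> vsp M i" if "i \<le> n" for i
    using N that by (auto simp: proper_submodule_def submodule_def)
  obtain k where k: "k \<le> n" "vsp N k \<noteq> vsp M k" using N by (auto simp: proper_submodule_def)
  show ?thesis
  proof (rule sum_strict_mono_ex1)
    show "\<forall>i\<in>{..n}. fs.dim (vsp N i) \<le> fs.dim (vsp M i)"
      using dim_mono_fin[OF vsp_fin[OF M] sub] by simp
    show "\<exists>i\<in>{..n}. fs.dim (vsp N i) < fs.dim (vsp M i)"
      using dim_less_fin[OF vsp_fin[OF M k(1)] sub[OF k(1)] k(2)] k(1) by auto
  qed simp
qed

text \<open>Take a non-zero submodule of weight \<open>0\<close> of least total dimension: its proper non-zero submodules have
  weight at most \<open>0\<close> by semistability of \<open>M\<close>, and not \<open>0\<close> by minimality.\<close>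

lemma exists_stable_submodule:
  fixes M :: "'k::field rep"
  assumes M: "Bmodule n M" and nz: "\<not> zero_rep n M" and ss: "semistable n v M"
  obtains N :: "'k rep" where "stable n v N"
proof -
  define P where "P N \<longleftrightarrow> submodule n N M \<and> \<not> zero_rep n N \<and> pairing n v (vsp N) = 0" for N
  have "P M" using submodule_refl[OF M] nz semistable_pairing_eq[OF ss] by (simp add: P_def)
  then obtain N where N: "P N" and min: "\<And>L. P L \<Longrightarrow> (\<Sum>i\<le>n. fs.dim (vsp N i)) \<le> (\<Sum>i\<le>n. fs.dim (vsp L i))"
    using ex_has_least_nat[of P M "\<lambda>N. \<Sum>i\<le>n. fs.dim (vsp N i)"] by blast
  have BN: "Bmodule n N" using submodule_Bmodule[OF M] N by (simp add: P_def)
  have "pairing n v (vsp L) < 0" if L: "proper_submodule n L N" "\<not> zero_rep n L" for L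
  proof -
    have LM: "submodule n L M"
      using L N submodule_trans[of n L N M] by (auto simp: P_def proper_submodule_def)
    have "\<not> P L" using min[of L] proper_submodule_dim_less[OF BN L(1)] by linarith
    then have "pairing n v (vsp L) \<noteq> 0" using LM L(2) by (simp add: P_def)
    then show ?thesis using semistable_submodule_le[OF ss LM] by linarith
  qed
  then have "stable n v N" using N BN by (simp add: stable_def P_def)
  then show thesis by (rule that)
qed

lemma stable_submodule_le:
  assumes "stable n v N" "submodule n L N"
  shows "pairing n v (vsp L) \<le> 0"
proof (rule semistable_submodule_le[OF _ assms(2)])
  show "semistable n v N" using assms(1)
    by (auto simp: stable_def semistable_def scalar_product_dimvec intro: less_imp_le)
qed

lemma stable_submodule_less:
  assumes "stable n v N" "submodule n (N\<lparr>vsp := U\<rparr>) N"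
    and "i \<le> n" "U i \<noteq> {0}" "j \<le> n" "U j \<noteq> vsp N j"
  shows "pairing n v U < 0"
  using assms unfolding stable_def proper_submodule_def zero_rep_def by fastforce

text \<open>The kernel and the image of \<open>f\<close> are submodules of \<open>N\<close>, hence of non-positive weight, and the weights
  add up to that of \<open>N\<close>, which is \<open>0\<close>. If \<open>f\<close> is neither injective nor zero, its kernel is non-zero and
  proper, so its weight is negative, which is impossible.\<close>

lemma stable_endo:
  assumes st: "stable n v N" and f: "hom n N N f"
    and x: "i \<le> n" "x \<in> vsp N i" "x \<noteq> 0" "f i x = 0"
    and y: "j \<le> n" "y \<in> vsp N j"
  shows "f j y = 0"
proof (rule ccontr)
  assume nz: "f j y \<noteq> 0"
  have B: "Bmodule n N" using st by (simp add: stable_def)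
  have lin: "flinear (f i)" and into: "\<And>x. x \<in> vsp N i \<Longrightarrow> f i x \<in> vsp N i" if "i \<le> n" for i
    using f that by (auto simp: hom_def)
  have comm: "\<And>x. x \<in> vsp N (Suc i) \<Longrightarrow> f i (al N i x) = al N i (f (Suc i) x)"
    "\<And>x. x \<in> vsp N i \<Longrightarrow> f (Suc i) (be N i x) = be N i (f i x)" if "i < n" for i
    using f that by (simp_all add: hom_def)
  let ?K = "\<lambda>i. {x \<in> vsp N i. f i x = 0}" and ?I = "\<lambda>i. f i ` vsp N i"
  have K: "submodule n (N\<lparr>vsp := ?K\<rparr>) N"
    unfolding submodule_restrict_iff
    using subspace_ker[OF lin vsp_sub[OF B]] comm al_in[OF B] be_in[OF B]
      flinear_zero[OF al_lin[OF B]] flinear_zero[OF be_lin[OF B]] by auto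
  have I: "submodule n (N\<lparr>vsp := ?I\<rparr>) N"
    unfolding submodule_restrict_iff
    using subspace_img[OF lin vsp_sub[OF B]] into comm[symmetric] al_in[OF B] be_in[OF B] by auto
  have "?K i \<noteq> {0}" "?K j \<noteq> vsp N j" using x y nz by blast+
  then have "pairing n v ?K < 0" using stable_submodule_less[OF st K x(1) _ y(1)] by blast
  moreover have "pairing n v ?I \<le> 0" using stable_submodule_le[OF st I] by simp
  moreover have "pairing n v (vsp N) = pairing n v ?I + pairing n v ?K"
    using rank_nullity[OF lin vsp_fin[OF B]]
    by (simp add: pairing_def sum.distrib[symmetric] distrib_left[symmetric])
  ultimately show False using st by (simp add: stable_def)
qed

text \<open>The element \<open>\<Sum>\<^sub>i \<beta>\<^sub>i\<alpha>\<^sub>i\<close> acts on every module by an endomorphism whose square is zero; at the vertex \<open>0\<close> it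
  acts by zero. On a stable module a nilpotent endomorphism vanishes, and the relation
  \<open>\<beta>\<^sub>i\<alpha>\<^sub>i = \<alpha>\<^bsub>i+1\<^esub>\<beta>\<^bsub>i+1\<^esub>\<close> then kills the paths \<open>\<alpha>\<beta>\<close> too.\<close>

lemma stable_rad_square_zero:
  assumes st: "stable n v N" and i: "i < n"
  shows "x \<in> vsp N (Suc i) \<Longrightarrow> be N i (al N i x) = 0"
    and "x \<in> vsp N i \<Longrightarrow> al N i (be N i x) = 0"
proof -
  have B: "Bmodule n N" using st by (simp add: stable_def)
  \<comment> \<open>The action of \<open>\<Sum>\<^sub>i \<beta>\<^sub>i\<alpha>\<^sub>i\<close>.\<close>
  define f where "f i = (if i = 0 then (\<lambda>x. 0) else be N (i - 1) \<circ> al N (i - 1))" for i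
  have f_Suc: "f (Suc i) x = be N i (al N i x)" for i x by (simp add: f_def)
  have be0: "be N k 0 = 0" and al0: "al N k 0 = 0" if "k < n" for k
    using flinear_zero al_lin[OF B that] be_lin[OF B that] by auto
  have abz: "al N k (be N k x) = f k x" if "x \<in> vsp N k" "k < n" for k x
    using that al_be_0[OF B] be_al[OF B, of "k - 1" x] by (cases k) (auto simp: f_def)
  have fal: "f k (al N k x) = 0" if "x \<in> vsp N (Suc k)" "k < n" for k x
    using that al_al[OF B, of "k - 1" x] be0 by (cases k) (auto simp: f_def)
  have bef: "be N k (f k x) = 0" if "x \<in> vsp N k" "k < n" for k x
    using that be_be[OF B, of "k - 1"] al_in[OF B, of "k - 1" x] be0 by (cases k) (auto simp: f_def)
  have hom: "hom n N N f"
    unfolding hom_def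
  proof (intro conjI allI impI ballI)
    fix k assume k: "k \<le> n"
    show "flinear (f k)"
      using k al_lin[OF B, of "k - 1"] be_lin[OF B, of "k - 1"]
      by (cases k) (auto simp: f_def fsp.linear_zero intro!: Vector_Spaces.linear_compose)
    show "f k ` vsp N k \<subseteq> vsp N k"
      using k al_in[OF B, of "k - 1"] be_in[OF B, of "k - 1"] fs.subspace_0[OF vsp_sub[OF B k]]
      by (cases k) (auto simp: f_def)
  next
    fix k x assume k: "k < n"
    show "f k (al N k x) = al N k (f (k + 1) x)" if x: "x \<in> vsp N (k + 1)"
      using fal[of x k] abz[of "al N k x" k] al_in[OF B k, of x] x k by (simp add: f_Suc)
    show "f (k + 1) (be N k x) = be N k (f k x)" if x: "x \<in> vsp N k"
      using bef[OF x k] abz[OF x k] by (simp add: f_Suc)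
  qed
  have ff: "f k (f k x) = 0" if "x \<in> vsp N k" "k \<le> n" for k x
  proof (cases k)
    case (Suc l)
    then have "al N l x \<in> vsp N l" using al_in[OF B] that by simp
    then have "al N l (be N l (al N l x)) = f l (al N l x)" using abz Suc that by simp
    then show ?thesis using fal[of x l] be0 Suc that by (simp add: f_Suc)
  qed (simp add: f_def)
  have fz: "f k x = 0" if x: "x \<in> vsp N k" "k \<le> n" for k x
  proof (rule ccontr)
    assume "f k x \<noteq> 0"
    moreover have "f k x \<in> vsp N k" using hom x by (auto simp: hom_def)
    ultimately have "f k x = 0" using stable_endo[OF st hom x(2) _ _ ff[OF x] x(2,1)] by blast
    then show False using \<open>f k x \<noteq> 0\<close> by simp
  qed
  show "x \<in> vsp N (Suc i) \<Longrightarrow> be N i (al N i x) = 0" using fz[of x "Suc i"] i by (simp add: f_Suc)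
  show "x \<in> vsp N i \<Longrightarrow> al N i (be N i x) = 0" using fz[of x i] abz[of x i] i by simp
qed

lemma point_submodule:
  assumes B: "Bmodule n N" and W: "i \<le> n" "fs.subspace W" "W \<subseteq> vsp N i"
    and "\<And>k x. i = Suc k \<Longrightarrow> x \<in> W \<Longrightarrow> al N k x = 0" "\<And>x. i < n \<Longrightarrow> x \<in> W \<Longrightarrow> be N i x = 0"
  shows "submodule n (N\<lparr>vsp := (\<lambda>j. if j = i then W else {0})\<rparr>) N"
  unfolding submodule_restrict_iff
proof (intro conjI allI impI ballI)
  fix j assume "j \<le> n"
  then show "fs.subspace (if j = i then W else {0})" "(if j = i then W else {0}) \<subseteq> vsp N j"
    using W fs.subspace_0[OF vsp_sub[OF B]] by auto
next
  fix j x assume j: "j < n"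
  have z: "0 \<in> (if k = i then W else {0})" for k using fs.subspace_0[OF W(2)] by simp
  show "al N j x \<in> (if j = i then W else {0})" if "x \<in> (if Suc j = i then W else {0})"
  proof -
    have "al N j x = 0" using that assms(5)[of j x] flinear_zero[OF al_lin[OF B j]] by (auto split: if_splits)
    then show ?thesis using z by simp
  qed
  show "be N j x \<in> (if Suc j = i then W else {0})" if "x \<in> (if j = i then W else {0})"
  proof -
    have "be N j x = 0" using that assms(6)[of x] flinear_zero[OF be_lin[OF B j]] j by (auto split: if_splits)
    then show ?thesis using z by simp
  qed
qed

lemma copoint_submodule:
  assumes B: "Bmodule n N" and W: "i \<le> n" "fs.subspace W" "W \<subseteq> vsp N i"
    and "\<And>k x. i = Suc k \<Longrightarrow> x \<in> vsp N k \<Longrightarrow> be N k x \<in> W"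
    and "\<And>x. i < n \<Longrightarrow> x \<in> vsp N (Suc i) \<Longrightarrow> al N i x \<in> W"
  shows "submodule n (N\<lparr>vsp := (\<lambda>j. if j = i then W else vsp N j)\<rparr>) N"
  unfolding submodule_restrict_iff
proof (intro conjI allI impI ballI)
  fix j assume "j \<le> n"
  then show "fs.subspace (if j = i then W else vsp N j)" "(if j = i then W else vsp N j) \<subseteq> vsp N j"
    using W vsp_sub[OF B] by auto
next
  fix j x assume j: "j < n"
  show "al N j x \<in> (if j = i then W else vsp N j)" if "x \<in> (if Suc j = i then W else vsp N (Suc j))"
  proof -
    have "x \<in> vsp N (Suc j)" using that W(3) by (auto split: if_splits)
    then show ?thesis using assms(6)[of x] al_in[OF B j, of x] j by auto
  qed
  show "be N j x \<in> (if Suc j = i then W else vsp N (Suc j))" if "x \<in> (if j = i then W else vsp N j)"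
  proof -
    have "x \<in> vsp N j" using that W(3) by (auto split: if_splits)
    then show ?thesis using assms(5)[of j x] be_in[OF B j, of x] by auto
  qed
qed

lemma pairing_update:
  assumes "i \<le> n"
  shows "pairing n v (\<lambda>j. if j = i then W else U j)
    = pairing n v U + v (n - i) * (real (fs.dim W) - real (fs.dim (U i)))"
proof -
  have "pairing n v (\<lambda>j. if j = i then W else U j)
      = (\<Sum>j\<le>n. v (n - j) * real (fs.dim (U j))
          + (if j = i then v (n - i) * (real (fs.dim W) - real (fs.dim (U i))) else 0))"
    unfolding pairing_def by (intro sum.cong) (auto simp: algebra_simps)
  also have "\<dots> = pairing n v U + v (n - i) * (real (fs.dim W) - real (fs.dim (U i)))"
    using assms by (simp add: sum.distrib pairing_def)
  finally show ?thesis .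
qed

lemma pairing_zero: "pairing n v (\<lambda>j. {0}) = 0"
  by (simp add: pairing_def)

text \<open>A proper submodule concentrated at \<open>i\<close> makes the weight of \<open>i\<close> negative. Dually, in
  \<open>stable_copoint_weight\<close>, a proper quotient concentrated at \<open>i\<close> makes it positive.\<close>

lemma stable_point_weight:
  assumes st: "stable n v N" and W: "i \<le> n" "fs.subspace W" "W \<subseteq> vsp N i" "W \<noteq> {0}"
    and "\<And>k x. i = Suc k \<Longrightarrow> x \<in> W \<Longrightarrow> al N k x = 0" "\<And>x. i < n \<Longrightarrow> x \<in> W \<Longrightarrow> be N i x = 0"
    and j: "j \<le> n" "j \<noteq> i" "vsp N j \<noteq> {0}"
  shows "v (n - i) < 0"
proof -
  have B: "Bmodule n N" using st by (simp add: stable_def)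
  let ?U = "\<lambda>j. if j = i then W else {0}"
  have "pairing n v ?U < 0"
    by (rule stable_submodule_less[OF st point_submodule[OF B W(1,2,3) assms(6,7)], of i j])
      (use W j in auto)
  then have "v (n - i) * real (fs.dim W) < 0"
    using pairing_update[OF W(1), of v W "\<lambda>j. {0}"] by (simp add: pairing_zero)
  then show ?thesis by (simp add: mult_less_0_iff)
qed

lemma stable_copoint_weight:
  assumes st: "stable n v N" and W: "i \<le> n" "fs.subspace W" "W \<subseteq> vsp N i" "W \<noteq> vsp N i"
    and "\<And>k x. i = Suc k \<Longrightarrow> x \<in> vsp N k \<Longrightarrow> be N k x \<in> W"
    and "\<And>x. i < n \<Longrightarrow> x \<in> vsp N (Suc i) \<Longrightarrow> al N i x \<in> W"
    and j: "j \<le> n" "j \<noteq> i" "vsp N j \<noteq> {0}"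
  shows "0 < v (n - i)"
proof -
  have B: "Bmodule n N" using st by (simp add: stable_def)
  let ?U = "\<lambda>j. if j = i then W else vsp N j"
  have "pairing n v ?U < 0"
    by (rule stable_submodule_less[OF st copoint_submodule[OF B W(1,2,3) assms(6,7)], of j i])
      (use W j in auto)
  then have "v (n - i) * (real (fs.dim W) - real (fs.dim (vsp N i))) < 0"
    using pairing_update[OF W(1), of v W "vsp N"] st by (simp add: stable_def)
  moreover have "fs.dim W < fs.dim (vsp N i)"
    by (rule dim_less_fin[OF vsp_fin[OF B W(1)] W(2-4)])
  ultimately show ?thesis by (simp add: mult_less_0_iff)
qed

lemma nontrivial: "y \<in> W \<Longrightarrow> y \<noteq> 0 \<Longrightarrow> W \<noteq> {0}"
  by blast

text \<open>The image of \<open>\<alpha>\<^sub>i\<close> is a submodule concentrated at \<open>i\<close>, and the image of every arrow into \<open>i + 1\<close> lies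
  in the kernel of \<open>\<alpha>\<^sub>i\<close>, because paths of length two act by zero; so \<open>N\<close> has a non-zero quotient
  concentrated at \<open>i + 1\<close>. The signs obtained here are opposite to those in
  \<open>stable_be_sign\<close>, so \<open>\<alpha>\<^sub>i\<close> and \<open>\<beta>\<^sub>i\<close> cannot both be non-zero.\<close>

lemma stable_al_sign:
  assumes st: "stable n v N" and i: "i < n" and x: "x \<in> vsp N (Suc i)" "al N i x \<noteq> 0"
  shows "v (n - i) < 0" "0 < v (n - Suc i)"
proof -
  have B: "Bmodule n N" using st by (simp add: stable_def)
  note s = vsp_sub[OF B]
  have nz: "vsp N i \<noteq> {0}" "vsp N (Suc i) \<noteq> {0}" "al N i ` vsp N (Suc i) \<noteq> {0}"
  proof -
    have "x \<noteq> 0" using x(2) flinear_zero[OF al_lin[OF B i]] by metis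
    then show "vsp N i \<noteq> {0}" "vsp N (Suc i) \<noteq> {0}"
      using nontrivial[OF al_in[OF B i x(1)] x(2)] nontrivial[OF x(1)] by fast+
    show "al N i ` vsp N (Suc i) \<noteq> {0}"
      by (rule nontrivial[OF imageI[OF x(1), of "al N i"] x(2)])
  qed
  show "v (n - i) < 0"
  proof (rule stable_point_weight[OF st, of i "al N i ` vsp N (Suc i)" "Suc i"])
    show "fs.subspace (al N i ` vsp N (Suc i))" using i by (intro subspace_img[OF al_lin[OF B] s]) auto
    show "al N k y = 0" if "i = Suc k" "y \<in> al N i ` vsp N (Suc i)" for k y
      using al_al[OF B, of k] that i by auto
    show "be N i y = 0" if "i < n" "y \<in> al N i ` vsp N (Suc i)" for y
      using stable_rad_square_zero(1)[OF st i] that by auto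
  qed (use i nz al_in[OF B i] in auto)
  show "0 < v (n - Suc i)"
  proof (rule stable_copoint_weight[OF st, of "Suc i" "{y \<in> vsp N (Suc i). al N i y = 0}" i])
    show "fs.subspace {y \<in> vsp N (Suc i). al N i y = 0}"
      using i by (intro subspace_ker[OF al_lin[OF B] s]) auto
    show "be N k y \<in> {y \<in> vsp N (Suc i). al N i y = 0}" if "Suc i = Suc k" "y \<in> vsp N k" for k y
      using stable_rad_square_zero(2)[OF st i] be_in[OF B] that i by auto
    show "al N (Suc i) y \<in> {y \<in> vsp N (Suc i). al N i y = 0}"
      if "Suc i < n" "y \<in> vsp N (Suc (Suc i))" for y
      using al_al[OF B that] al_in[OF B that] by auto
    show "{y \<in> vsp N (Suc i). al N i y = 0} \<noteq> vsp N (Suc i)" using x by blast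
  qed (use i nz in auto)
qed

lemma stable_be_sign:
  assumes st: "stable n v N" and i: "i < n" and x: "x \<in> vsp N i" "be N i x \<noteq> 0"
  shows "v (n - Suc i) < 0" "0 < v (n - i)"
proof -
  have B: "Bmodule n N" using st by (simp add: stable_def)
  note s = vsp_sub[OF B]
  have nz: "vsp N i \<noteq> {0}" "vsp N (Suc i) \<noteq> {0}" "be N i ` vsp N i \<noteq> {0}"
  proof -
    have "x \<noteq> 0" using x(2) flinear_zero[OF be_lin[OF B i]] by metis
    then show "vsp N i \<noteq> {0}" "vsp N (Suc i) \<noteq> {0}"
      using nontrivial[OF be_in[OF B i x(1)] x(2)] nontrivial[OF x(1)] by fast+
    show "be N i ` vsp N i \<noteq> {0}"
      by (rule nontrivial[OF imageI[OF x(1), of "be N i"] x(2)])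
  qed
  show "v (n - Suc i) < 0"
  proof (rule stable_point_weight[OF st, of "Suc i" "be N i ` vsp N i" i])
    show "fs.subspace (be N i ` vsp N i)" using i by (intro subspace_img[OF be_lin[OF B] s]) auto
    show "al N k y = 0" if "Suc i = Suc k" "y \<in> be N i ` vsp N i" for k y
      using stable_rad_square_zero(2)[OF st i] that by auto
    show "be N (Suc i) y = 0" if "Suc i < n" "y \<in> be N i ` vsp N i" for y
      using be_be[OF B that(1)] that by auto
  qed (use i nz be_in[OF B i] in auto)
  show "0 < v (n - i)"
  proof (rule stable_copoint_weight[OF st, of i "{y \<in> vsp N i. be N i y = 0}" "Suc i"])
    show "fs.subspace {y \<in> vsp N i. be N i y = 0}"
      using i by (intro subspace_ker[OF be_lin[OF B] s]) auto
    show "be N k y \<in> {y \<in> vsp N i. be N i y = 0}" if "i = Suc k" "y \<in> vsp N k" for k y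
      using be_be[OF B, of k y] be_in[OF B, of k y] that i by auto
    show "al N i y \<in> {y \<in> vsp N i. be N i y = 0}" if "i < n" "y \<in> vsp N (Suc i)" for y
      using stable_rad_square_zero(1)[OF st i that(2)] al_in[OF B i that(2)] by auto
    show "{y \<in> vsp N i. be N i y = 0} \<noteq> vsp N i" using x by blast
  qed (use i nz in auto)
qed

section \<open>Stable modules are zigzags of multiplicity one\<close>

text \<open>After choosing bases, a family of endomorphisms of the spaces of \<open>N\<close> has \<open>\<Sum> d\<^sub>i\<^sup>2\<close> unknown coefficients.
  Between neighbouring vertices at most one arrow is non-zero, so commuting with the arrows takes at
  most \<open>\<Sum> d\<^sub>i d\<^bsub>i+1\<^esub>\<close> equations, and killing a chosen basis vector at \<open>i0\<close> takes \<open>d\<close> more, with \<open>d\<close> the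
  dimension at \<open>i0\<close>. If the inequality failed, there would be a non-zero endomorphism that kills a
  non-zero vector, contrary to \<open>stable_endo\<close>.\<close>

lemma stable_euler_bound:
  assumes st: "stable n v N" and i0: "i0 \<le> n" "0 < fs.dim (vsp N i0)"
  shows "(\<Sum>i\<le>n. fs.dim (vsp N i) * fs.dim (vsp N i))
     \<le> (\<Sum>i<n. fs.dim (vsp N i) * fs.dim (vsp N (Suc i))) + fs.dim (vsp N i0)"
proof (rule ccontr)
  let ?d = "\<lambda>i. fs.dim (vsp N i)"
  assume "\<not> ?thesis"
  then have less: "(\<Sum>i<n. ?d i * ?d (Suc i)) + ?d i0 < (\<Sum>i\<le>n. ?d i * ?d i)" by simp
  have BN: "Bmodule n N" using st by (simp add: stable_def)
  have "\<exists>B. B \<subseteq> vsp N i \<and> fs.independent B \<and> fs.span B = vsp N i \<and> finite B \<and> card B = ?d i"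
    if "i \<le> n" for i
    using fin_dim_basis[OF vsp_fin[OF BN that]] by metis
  then obtain B where B: "\<And>i. i \<le> n \<Longrightarrow> B i \<subseteq> vsp N i" "\<And>i. i \<le> n \<Longrightarrow> fs.independent (B i)"
    "\<And>i. i \<le> n \<Longrightarrow> fs.span (B i) = vsp N i" "\<And>i. i \<le> n \<Longrightarrow> finite (B i)"
    "\<And>i. i \<le> n \<Longrightarrow> card (B i) = ?d i" by metis
  obtain b0 where b0: "b0 \<in> B i0" using B(5)[OF i0(1)] i0(2) by fastforce
  \<comment> \<open>Keep one arrow \<open>a i\<close> per gap, from \<open>src i\<close> to \<open>tgt i\<close>; the discarded one acts by zero.\<close>
  define P where "P i \<longleftrightarrow> (\<exists>x\<in>vsp N (Suc i). al N i x \<noteq> 0)" for i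
  define src where "src i = (if P i then Suc i else i)" for i
  define tgt where "tgt i = (if P i then i else Suc i)" for i
  define a where "a i = (if P i then al N i else be N i)" for i
  have sn: "src i \<le> n" "tgt i \<le> n" if "i < n" for i using that by (auto simp: src_def tgt_def)
  have a_lin: "flinear (a i)" if "i < n" for i
    using al_lin[OF BN that] be_lin[OF BN that] by (simp add: a_def)
  have a_in: "a i x \<in> vsp N (tgt i)" if "i < n" "x \<in> vsp N (src i)" for i x
    using al_in[OF BN that(1), of x] be_in[OF BN that(1), of x] that(2)
    by (simp add: a_def src_def tgt_def split: if_splits)
  \<comment> \<open>The endomorphism of the space at \<open>i\<close> with coefficients \<open>x (i, b, b')\<close>.\<close>
  define F where "F x i = fsp.construct (B i) (\<lambda>b. \<Sum>b'\<in>B i. fscale (x (i, b, b')) b')" for x i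
  have F_lin: "flinear (F x i)" if "i \<le> n" for x i
    unfolding F_def by (rule fsp.linear_construct[OF B(2)[OF that]])
  have F_basis: "F x i b = (\<Sum>b'\<in>B i. fscale (x (i, b, b')) b')" if "i \<le> n" "b \<in> B i" for x i b
    unfolding F_def by (rule fsp.construct_basis[OF B(2)[OF that(1)] that(2)])
  have F_in: "F x i y \<in> vsp N i" if "i \<le> n" for x i y
  proof -
    have "F x i y \<in> fs.span ((\<lambda>b. \<Sum>b'\<in>B i. fscale (x (i, b, b')) b') ` B i)"
      unfolding F_def by (rule fsp.construct_in_span[OF B(2)[OF that]])
    also have "\<dots> \<subseteq> vsp N i"
      using B(1)[OF that] vsp_sub[OF BN that]
      by (intro fs.span_minimal) (auto intro!: fs.subspace_sum fs.subspace_scale)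
    finally show ?thesis .
  qed
  have F_add: "F (\<lambda>t. x t + y t) i z = F x i z + F y i z" if "i \<le> n" for x y i z
  proof -
    have "F (\<lambda>t. x t + y t) i z = fsp.construct (B i) (\<lambda>b. (\<Sum>b'\<in>B i. fscale (x (i, b, b')) b')
        + (\<Sum>b'\<in>B i. fscale (y (i, b, b')) b')) z"
      unfolding F_def by (simp add: fs.scale_left_distrib sum.distrib)
    also have "\<dots> = F x i z + F y i z"
      unfolding F_def by (rule fsp.construct_add[OF B(2)[OF that]])
    finally show ?thesis .
  qed
  have F_scale: "F (\<lambda>t. c * x t) i z = fscale c (F x i z)" if "i \<le> n" for c x i z
  proof -
    have "F (\<lambda>t. c * x t) i z = fsp.construct (B i) (\<lambda>b. fscale c (\<Sum>b'\<in>B i. fscale (x (i, b, b')) b')) z"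
      unfolding F_def by (simp add: fs.scale_sum_right)
    also have "\<dots> = fscale c (F x i z)"
      unfolding F_def by (rule fsp.construct_scale[OF B(2)[OF that]])
    finally show ?thesis .
  qed
  \<comment> \<open>The failure of \<open>F x\<close> to commute with \<open>a i\<close> on the basis vector \<open>b\<close>; it is linear in \<open>x\<close>.\<close>
  define G where "G x i b = F x (tgt i) (a i b) - a i (F x (src i) b)" for x i b
  have G_in: "G x i b \<in> fs.span (B (tgt i))" if "i < n" for x i b
    using fs.subspace_diff[OF vsp_sub[OF BN sn(2)[OF that]] F_in[OF sn(2)[OF that]] a_in[OF that F_in[OF sn(1)[OF that]]]]
      B(3)[OF sn(2)[OF that]] by (simp add: G_def)
  have G_add: "G (\<lambda>t. x t + y t) i b = G x i b + G y i b" if "i < n" for x y i b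
    unfolding G_def F_add[OF sn(1)[OF that]] F_add[OF sn(2)[OF that]]
    by (simp add: fsp.linear_add[OF a_lin[OF that]] algebra_simps)
  have G_scale: "G (\<lambda>t. c * x t) i b = fscale c (G x i b)" if "i < n" for c x i b
    unfolding G_def F_scale[OF sn(1)[OF that]] F_scale[OF sn(2)[OF that]]
    by (simp add: fsp.linear_scale[OF a_lin[OF that]] fs.scale_right_diff_distrib)
  let ?I = "SIGMA i:{..n}. B i \<times> B i"
  let ?J1 = "SIGMA i:{..<n}. B (src i) \<times> B (tgt i)"
  let ?J = "?J1 <+> B i0"
  define L where "L j x = (case j of Inl (i, b, b') \<Rightarrow> fs.representation (B (tgt i)) (G x i b) b'
    | Inr b' \<Rightarrow> x (i0, b0, b'))" for j x
  have fin: "finite ?I" "finite ?J1" "finite ?J" using B(4) sn i0 by auto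
  have cI: "card ?I = (\<Sum>i\<le>n. ?d i * ?d i)"
    using B(4,5) by (simp add: card_cartesian_product)
  have cJ1: "card ?J1 = (\<Sum>i<n. ?d i * ?d (Suc i))"
  proof -
    have "card ?J1 = (\<Sum>i<n. ?d (src i) * ?d (tgt i))"
      using B(4,5) sn by (simp add: card_cartesian_product)
    also have "\<dots> = (\<Sum>i<n. ?d i * ?d (Suc i))"
      by (intro sum.cong) (auto simp: src_def tgt_def)
    finally show ?thesis .
  qed
  have "card ?J < card ?I"
    using less fin B(4,5) i0 by (simp only: card_Plus cI cJ1)
  then obtain x where x: "\<exists>t\<in>?I. x t \<noteq> 0" "\<forall>j\<in>?J. L j x = 0"
  proof (rule underdetermined[where L = L, OF fin(3,1)])
    fix j x y assume "j \<in> ?J"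
    then show "L j (\<lambda>t. x t + y t) = L j x + L j y"
      using fs.representation_add[OF B(2)[OF sn(2)] G_in G_in]
      by (auto simp: L_def G_add)
  next
    fix j c x assume "j \<in> ?J"
    then show "L j (\<lambda>t. c * x t) = c * L j x"
      using fs.representation_scale[OF B(2)[OF sn(2)] G_in]
      by (auto simp: L_def G_scale)
  qed blast
  have G0: "G x i b = 0" if i: "i < n" "b \<in> B (src i)" for i b
  proof -
    have "fs.representation (B (tgt i)) (G x i b) b' = 0" if b': "b' \<in> B (tgt i)" for b'
    proof -
      have "Inl (i, b, b') \<in> ?J" using i b' by auto
      then have "L (Inl (i, b, b')) x = 0" using x(2) by blast
      then show ?thesis by (simp add: L_def)
    qed
    then have "fs.representation (B (tgt i)) (G x i b) = (\<lambda>_. 0)"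
      using fs.representation_ne_zero by (intro ext) blast
    then show ?thesis
      using fs.sum_nonzero_representation_eq[OF B(2)[OF sn(2)[OF i(1)]] G_in[OF i(1)], of x b] by simp
  qed
  have comm: "F x (tgt i) (a i y) = a i (F x (src i) y)" if i: "i < n" "y \<in> vsp N (src i)" for i y
  proof -
    have "(F x (tgt i) \<circ> a i) y = (a i \<circ> F x (src i)) y"
    proof (rule fsp.linear_eq_on[where B = "B (src i)" and f = "F x (tgt i) \<circ> a i"
          and g = "a i \<circ> F x (src i)"])
      show "flinear (F x (tgt i) \<circ> a i)" "flinear (a i \<circ> F x (src i))"
        using Vector_Spaces.linear_compose[OF a_lin F_lin] Vector_Spaces.linear_compose[OF F_lin a_lin]
          i sn by auto
      show "y \<in> fs.span (B (src i))" using B(3) sn i by simp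
      show "(F x (tgt i) \<circ> a i) b = (a i \<circ> F x (src i)) b" if "b \<in> B (src i)" for b
        using G0[OF i(1) that] by (simp add: G_def)
    qed
    then show ?thesis by simp
  qed
  have be0: "be N i y = 0" if "P i" "i < n" "y \<in> vsp N i" for i y
    using that stable_al_sign[OF st] stable_be_sign[OF st] unfolding P_def by (meson less_asym)
  have hom: "hom n N N (F x)"
    unfolding hom_def
  proof (intro conjI allI impI ballI)
    fix i assume i: "i \<le> n"
    show "flinear (F x i)" by (rule F_lin[OF i])
    show "F x i ` vsp N i \<subseteq> vsp N i" using F_in[OF i] by blast
  next
    fix i y assume i: "i < n"
    have F0: "F x k 0 = 0" if "k \<le> n" for k by (rule flinear_zero[OF F_lin[OF that]])
    show "F x i (al N i y) = al N i (F x (i + 1) y)" if y: "y \<in> vsp N (i + 1)"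
    proof (cases "P i")
      case True
      then show ?thesis using comm[OF i, of y] y by (simp add: src_def tgt_def a_def)
    next
      case False
      then have "al N i y = 0" "al N i (F x (i + 1) y) = 0"
        using y F_in[of "i + 1" x y] i by (auto simp: P_def)
      then show ?thesis using F0[of i] i by simp
    qed
    show "F x (i + 1) (be N i y) = be N i (F x i y)" if y: "y \<in> vsp N i"
    proof (cases "P i")
      case True
      then have "be N i y = 0" "be N i (F x i y) = 0"
        using y F_in[of i x y] i be0 by auto
      then show ?thesis using F0[of "i + 1"] i by simp
    next
      case False
      then show ?thesis using comm[OF i, of y] y by (simp add: src_def tgt_def a_def)
    qed
  qed
  have "F x i0 b0 = 0"
  proof -
    have "x (i0, b0, b') = 0" if b': "b' \<in> B i0" for b'
    proof -
      have "L (Inr b') x = 0" using x(2) b' by blast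
      then show ?thesis by (simp add: L_def)
    qed
    then show ?thesis using F_basis[OF i0(1) b0] by simp
  qed
  moreover have "b0 \<noteq> 0" using b0 B(2)[OF i0(1)] fs.dependent_zero by metis
  ultimately have F0: "F x j y = 0" if "j \<le> n" "y \<in> vsp N j" for j y
    using stable_endo[OF st hom i0(1) _ _ _ that] b0 B(1)[OF i0(1)] by blast
  obtain i b b' where t: "i \<le> n" "b \<in> B i" "b' \<in> B i" "x (i, b, b') \<noteq> 0" using x(1) by auto
  have "(\<Sum>c\<in>B i. fscale (x (i, b, c)) c) = 0"
    using F_basis[OF t(1,2), of x] F0[OF t(1), of b] B(1)[OF t(1)] t(2) by auto
  then have "x (i, b, b') = 0"
    using fs.independentD[OF B(2)[OF t(1)] B(4)[OF t(1)] order_refl, of "\<lambda>c. x (i, b, c)"] t(3) by blast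
  then show False using t(4) by simp
qed

text \<open>Twice the Euler form of type A is a sum of squares of the successive differences of the dimension
  vector, extended by \<open>0\<close> at both ends.\<close>

lemma double_euler_form:
  fixes D :: "nat \<Rightarrow> int"
  shows "2 * ((\<Sum>i\<le>n. D i * D i) - (\<Sum>i<n. D i * D (Suc i)))
    = D 0 * D 0 + D n * D n + (\<Sum>i<n. (D (Suc i) - D i) * (D (Suc i) - D i))"
proof (induction n)
  case (Suc n)
  then show ?case by (simp add: algebra_simps)
qed simp

text \<open>Apply the bound at a vertex where the smallest positive dimension \<open>m\<close> is attained: the squares of
  the successive differences add up to at most \<open>2m\<close>. The step up to the first and the step down from
  the last vertex of the support already contribute \<open>2m\<^sup>2\<close>. Hence \<open>m = 1\<close>, both steps have height one, and
  there are no other steps.\<close>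

lemma euler_bound_interval:
  fixes d :: "nat \<Rightarrow> nat"
  assumes bound: "\<And>i. i \<le> n \<Longrightarrow> 0 < d i \<Longrightarrow> (\<Sum>i\<le>n. d i * d i) \<le> (\<Sum>i<n. d i * d (Suc i)) + d i"
    and nz: "k \<le> n" "0 < d k"
  obtains c e where "c \<le> e" "e \<le> n" "\<And>i. i \<le> n \<Longrightarrow> d i = (if c \<le> i \<and> i \<le> e then 1 else 0)"
proof -
  let ?S = "{i. i \<le> n \<and> 0 < d i}"
  have S: "finite ?S" "?S \<noteq> {}" using nz by auto
  define c where "c = Min ?S"
  define e where "e = Max ?S"
  have c: "c \<le> n" "0 < d c" and e: "e \<le> n" "0 < d e"
    using Min_in[OF S] Max_in[OF S] by (auto simp: c_def e_def)
  have ce: "c \<le> e" using c S by (simp add: e_def)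
  have out: "d i = 0" if "i \<le> n" "\<not> (c \<le> i \<and> i \<le> e)" for i
  proof (rule ccontr)
    assume "d i \<noteq> 0"
    then have "i \<in> ?S" using that by simp
    then show False using that(2) S by (auto simp: c_def e_def)
  qed
  obtain m where m: "m \<in> ?S" "\<And>i. i \<in> ?S \<Longrightarrow> d m \<le> d i"
    using ex_has_least_nat[of "\<lambda>i. i \<in> ?S" _ d] S(2) by blast
  \<comment> \<open>\<open>d\<close> shifted by one and extended by \<open>0\<close> on both sides; \<open>q j\<close> is the squared step at \<open>j\<close>.\<close>
  define D where "D j = (if j = 0 \<or> Suc n < j then 0 else int (d (j - 1)))" for j
  define q where "q j = (D (Suc j) - D j) * (D (Suc j) - D j)" for j
  have q0: "0 \<le> q j" for j by (simp add: q_def)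
  have sumq: "(\<Sum>j<n + 2. q j) \<le> 2 * int (d m)"
  proof -
    let ?E = "\<lambda>i. int (d i)"
    have "(\<Sum>j<n + 2. q j) = q 0 + (\<Sum>j<n. q (Suc j)) + q (Suc n)"
      using sum.lessThan_Suc[of q "Suc n"] sum.lessThan_Suc_shift[of q n]
      by (simp only: add_2_eq_Suc')
    also have "\<dots> = ?E 0 * ?E 0 + ?E n * ?E n + (\<Sum>i<n. (?E (Suc i) - ?E i) * (?E (Suc i) - ?E i))"
      by (simp add: q_def D_def)
    also have "\<dots> = 2 * ((\<Sum>i\<le>n. ?E i * ?E i) - (\<Sum>i<n. ?E i * ?E (Suc i)))"
      by (rule double_euler_form[symmetric])
    also have "(\<Sum>i\<le>n. ?E i * ?E i) \<le> (\<Sum>i<n. ?E i * ?E (Suc i)) + ?E m"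
      using bound[of m] m(1) by (simp flip: of_nat_mult of_nat_sum of_nat_add)
    finally show ?thesis by simp
  qed
  have qc: "q c = int (d c) * int (d c)" 
    using out[of "c - 1"] c by (cases c) (auto simp: q_def D_def)
  have qe: "q (Suc e) = int (d e) * int (d e)"
    using out[of "Suc e"] e by (auto simp: q_def D_def)
  have split: "(\<Sum>j<n + 2. q j) = q c + q (Suc e) + (\<Sum>j\<in>{..<n + 2} - {c, Suc e}. q j)"
  proof -
    have "(\<Sum>j<n + 2. q j) = (\<Sum>j\<in>{c, Suc e}. q j) + (\<Sum>j\<in>{..<n + 2} - {c, Suc e}. q j)"
      using c e by (intro sum.subset_diff[THEN trans]) (auto simp: add.commute)
    then show ?thesis using ce by simp
  qed
  have rest: "0 \<le> (\<Sum>j\<in>{..<n + 2} - {c, Suc e}. q j)" using q0 by (intro sum_nonneg) auto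
  have mpos: "0 < d m" "d m \<le> d c" "d m \<le> d e" using m c e by auto
  have sq: "int (d m) * int (d m) \<le> int (d c) * int (d c)" "int (d m) * int (d m) \<le> int (d e) * int (d e)"
    "int (d c) \<le> int (d c) * int (d c)" "int (d e) \<le> int (d e) * int (d e)"
    using mpos by (auto intro!: mult_mono simp: mult_le_cancel_left1)
  have "int (d m) * int (d m) \<le> int (d m)" using sumq split rest qc qe sq by linarith
  then have m1: "d m = 1" using mpos(1) by (simp add: mult_le_cancel_left1 mult_le_cancel_left2)
  then have rest0: "(\<Sum>j\<in>{..<n + 2} - {c, Suc e}. q j) = 0" and "int (d c) \<le> 1"
    using sumq split rest qc qe sq mpos by linarith+
  then have dc: "d c = 1" using c by simp
  have const: "i \<le> e \<Longrightarrow> d i = 1" if "c \<le> i" for i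
    using that
  proof (induction i rule: dec_induct)
    case base
    show ?case by (rule dc)
  next
    case (step i)
    then have "Suc i \<in> {..<n + 2} - {c, Suc e}" using e by auto
    then have "q (Suc i) = 0" using rest0 q0 by (simp add: sum_nonneg_eq_0_iff)
    then show ?case using step e by (simp add: q_def D_def)
  qed
  show thesis
    by (rule that[OF ce e(1)]) (use const out in auto)
qed

lemma bij_betw_if_dim_le_1:
  assumes f: "flinear f" and V: "fin_dim_subspace V" and W: "fin_dim_subspace W" "f ` V \<subseteq> W"
    and d: "fs.dim V = 1" "fs.dim W = 1" and x: "x \<in> V" "f x \<noteq> 0"
  shows "bij_betw f V W"
proof -
  have sV: "fs.subspace V" using V by (simp add: fin_dim_subspace_def)
  have "f ` V \<noteq> {0}" using x by blast
  then have "fs.dim (f ` V) \<noteq> 0" using dim_eq_0_iff[OF fin_dim_image[OF f V]] by blast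
  then have r: "fs.dim (f ` V) = 1" "fs.dim {x \<in> V. f x = 0} = 0"
    using rank_nullity[OF f V] d(1) by linarith+
  then have "f ` V = W" using dim_eq_fin[OF W(1) subspace_img[OF f sV] W(2)] d(2) by simp
  moreover have "{x \<in> V. f x = 0} = {0}"
    using dim_eq_0_iff[OF fin_dim_subspace_subset[OF V subspace_ker[OF f sV]]] r(2) by blast
  then have "inj_on f V" unfolding inj_on_ker[OF f sV] by blast
  ultimately show ?thesis by (simp add: bij_betw_def)
qed

text \<open>If both arrows between two neighbouring vertices of the support were zero, both parts of \<open>N\<close> would
  be submodules of negative weight, although their weights add up to \<open>0\<close>.\<close>

lemma stable_zigzag:
  assumes st: "stable n v N"
  obtains c e p where "zigzag n c e p 1 N"
proof -
  have B: "Bmodule n N" using st by (simp add: stable_def)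
  obtain k where k: "k \<le> n" "vsp N k \<noteq> {0}" using st by (auto simp: stable_def zero_rep_def)
  have "0 < fs.dim (vsp N k)" using dim_eq_0_iff[OF vsp_fin[OF B k(1)]] k(2) by blast
  then obtain c e where ce: "c \<le> e" "e \<le> n"
    and d: "\<And>i. i \<le> n \<Longrightarrow> fs.dim (vsp N i) = (if c \<le> i \<and> i \<le> e then 1 else 0)"
    using euler_bound_interval[where d = "\<lambda>i. fs.dim (vsp N i)", OF stable_euler_bound[OF st] k(1)]
    by metis
  have dims: "interval_dims n c e 1 N" using ce d by (simp add: interval_dims_def)
  have "gap_down N q \<or> gap_up N q" if q: "c \<le> q" "q < e" for q
  proof -
    have qn: "q < n" using q ce by simp
    have d1: "fs.dim (vsp N q) = 1" "fs.dim (vsp N (Suc q)) = 1" using d q qn by auto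
    have nz: "vsp N q \<noteq> {0}" "vsp N (Suc q) \<noteq> {0}" using d1 dim_zero_space by (metis zero_neq_one)+
    note fin = vsp_fin[OF B less_imp_le[OF qn]] vsp_fin[OF B Suc_leI[OF qn]]
    consider (down) x where "x \<in> vsp N (Suc q)" "al N q x \<noteq> 0"
      | (up) x where "x \<in> vsp N q" "be N q x \<noteq> 0"
      | (none) "\<forall>x\<in>vsp N (Suc q). al N q x = 0" "\<forall>x\<in>vsp N q. be N q x = 0" by blast
    then show ?thesis
    proof cases
      case down
      have "bij_betw (al N q) (vsp N (Suc q)) (vsp N q)"
        using al_in[OF B qn] d1 down fin by (intro bij_betw_if_dim_le_1[OF al_lin[OF B qn]]) auto
      moreover have "\<forall>y\<in>vsp N q. be N q y = 0"
        using stable_al_sign[OF st qn down] stable_be_sign[OF st qn] by (meson less_asym)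
      ultimately show ?thesis by (simp add: gap_down_def)
    next
      case up
      have "bij_betw (be N q) (vsp N q) (vsp N (Suc q))"
        using be_in[OF B qn] d1 up fin by (intro bij_betw_if_dim_le_1[OF be_lin[OF B qn]]) auto
      moreover have "\<forall>y\<in>vsp N (Suc q). al N q y = 0"
        using stable_be_sign[OF st qn up] stable_al_sign[OF st qn] by (meson less_asym)
      ultimately show ?thesis by (simp add: gap_up_def)
    next
      case none
      let ?U = "\<lambda>i. if i \<le> q then vsp N i else {0}" and ?W = "\<lambda>i. if q < i then vsp N i else {0}"
      have "pairing n v ?U < 0"
        using nz qn by (intro stable_submodule_less[OF st lower_cut_submodule[OF B qn none(2)], of q "Suc q"]) auto
      moreover have "pairing n v ?W < 0"
        using nz qn by (intro stable_submodule_less[OF st upper_cut_submodule[OF B qn none(1)], of "Suc q" q]) auto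
      moreover have "pairing n v (vsp N) = pairing n v ?U + pairing n v ?W"
        unfolding pairing_def sum.distrib[symmetric] by (intro sum.cong) auto
      ultimately show ?thesis using st by (simp add: stable_def)
    qed
  qed
  then show thesis using gaps_alternate[OF B dims] that by blast
qed

lemma semistable_in_zigzag_cone:
  fixes M :: "'k::field rep"
  assumes M: "Bmodule n M" "\<not> zero_rep n M" and v: "v \<in> stability_space n M"
  obtains c e p where "c \<le> e" "e \<le> n" "v \<in> zigzag_cone n c e p"
proof -
  have ss: "semistable n v M" and E: "v \<in> topspace (Euclidean_space (n + 1))"
    using v by (auto simp: stability_space_def)
  obtain N :: "'k rep" where st: "stable n v N" by (rule exists_stable_submodule[OF M ss])
  obtain c e p where z: "zigzag n c e p 1 N" by (rule stable_zigzag[OF st])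
  have B: "Bmodule n N" using st by (simp add: stable_def)
  have "semistable n v N" using st
    by (auto simp: stable_def semistable_def scalar_product_dimvec intro: less_imp_le)
  then have "v \<in> zigzag_cone n c e p"
    unfolding stability_space_zigzag[OF B z, symmetric] stability_space_def using E by blast
  moreover have "c \<le> e" "e \<le> n" using z by (auto simp: zigzag_def interval_dims_def)
  ultimately show thesis using that by blast
qed

section \<open>Modules whose stability space is a wall are zigzags\<close>

text \<open>Two independent linear equations leave at most \<open>n - 1\<close> dimensions: Cramer's rule expresses the
  coordinates \<open>j\<close> and \<open>k\<close> through the remaining ones.\<close>

lemma dim_less_two_functionals:
  fixes C :: "(nat \<Rightarrow> real) set"
  assumes C: "C \<subseteq> topspace (Euclidean_space (n + 1))"
    and phi: "\<And>x. x \<in> C \<Longrightarrow> (\<Sum>i\<le>n. \<phi> i * x i) = 0"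
    and psi: "\<And>x. x \<in> C \<Longrightarrow> (\<Sum>i\<le>n. \<psi> i * x i) = 0"
    and jk: "j \<le> n" "k \<le> n" "\<phi> j * \<psi> k \<noteq> \<phi> k * \<psi> j"
  shows "fs.dim C < n"
proof -
  define \<Delta> where "\<Delta> = \<phi> j * \<psi> k - \<phi> k * \<psi> j"
  have \<Delta>: "\<Delta> \<noteq> 0" and ne: "j \<noteq> k" using jk by (auto simp: \<Delta>_def)
  define S where "S = {..n} - {j, k}"
  define a where "a i = - (\<phi> i * \<psi> k - \<phi> k * \<psi> i) / \<Delta>" for i
  define b where "b i = - (\<phi> j * \<psi> i - \<phi> i * \<psi> j) / \<Delta>" for i
  define u where "u i = (\<lambda>t. if t = i then 1 else if t = j then a i else if t = k then b i else 0)" for i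
  have "C \<subseteq> fs.span (u ` S)"
  proof
    fix x assume x: "x \<in> C"
    define y where "y = (\<Sum>i\<in>S. fscale (x i) (u i))"
    have y: "y \<in> fs.span (u ` S)"
      unfolding y_def by (intro fs.span_sum fs.span_scale fs.span_base) auto
    have yt: "y t = (\<Sum>i\<in>S. x i * u i t)" for t
    proof -
      have "(\<Sum>i\<in>F. fscale (x i) (u i)) t = (\<Sum>i\<in>F. x i * u i t)" if "finite F" for F
        using that by (induction F) (auto simp: fscale_def)
      then show ?thesis by (simp add: y_def S_def)
    qed
    have rest: "(\<Sum>i\<in>S. \<theta> i * x i) = - \<theta> j * x j - \<theta> k * x k"
      if "(\<Sum>i\<le>n. \<theta> i * x i) = 0" for \<theta> :: "nat \<Rightarrow> real"
    proof -
      have "(\<Sum>i\<le>n. \<theta> i * x i) = (\<Sum>i\<in>S. \<theta> i * x i) + (\<Sum>i\<in>{j, k}. \<theta> i * x i)"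
        unfolding S_def using jk by (intro sum.subset_diff) auto
      then show ?thesis using that ne by simp
    qed
    note R = rest[OF phi[OF x]] rest[OF psi[OF x]]
    have lin: "(\<Sum>i\<in>S. x i * (- (\<phi> i * p - q * \<psi> i) / \<Delta>))
      = - ((\<Sum>i\<in>S. \<phi> i * x i) * p - q * (\<Sum>i\<in>S. \<psi> i * x i)) / \<Delta>" for p q
      by (simp add: sum_distrib_left sum_distrib_right sum_divide_distrib sum_subtractf[symmetric]
          sum_negf[symmetric] algebra_simps)
    have lin2: "(\<Sum>i\<in>S. x i * (- (p * \<psi> i - \<phi> i * q) / \<Delta>))
      = - (p * (\<Sum>i\<in>S. \<psi> i * x i) - (\<Sum>i\<in>S. \<phi> i * x i) * q) / \<Delta>" for p q
      by (simp add: sum_distrib_left sum_distrib_right sum_divide_distrib sum_subtractf[symmetric]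
          sum_negf[symmetric] algebra_simps)
    have "x t = y t" for t
    proof -
      consider "t = j" | "t = k" | "t \<in> S" | "n < t"
        by (cases "t = j"; cases "t = k"; cases "t \<le> n") (auto simp: S_def)
      then show ?thesis
      proof cases
        case 1
        have "y t = (\<Sum>i\<in>S. x i * a i)"
          unfolding yt by (intro sum.cong) (auto simp: u_def 1 S_def)
        also have "\<dots> = - ((- \<phi> j * x j - \<phi> k * x k) * \<psi> k - \<phi> k * (- \<psi> j * x j - \<psi> k * x k)) / \<Delta>"
          unfolding a_def lin R ..
        also have "\<dots> = \<Delta> * x j / \<Delta>" by (simp add: \<Delta>_def algebra_simps)
        finally show ?thesis using \<Delta> 1 by simp
      next
        case 2
        have "y t = (\<Sum>i\<in>S. x i * b i)"
          unfolding yt using ne by (intro sum.cong) (auto simp: u_def 2 S_def)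
        also have "\<dots> = - (\<phi> j * (- \<psi> j * x j - \<psi> k * x k) - (- \<phi> j * x j - \<phi> k * x k) * \<psi> j) / \<Delta>"
          unfolding b_def lin2 R ..
        also have "\<dots> = \<Delta> * x k / \<Delta>" by (simp add: \<Delta>_def algebra_simps)
        finally show ?thesis using \<Delta> 2 by simp
      next
        case 3
        have "y t = (\<Sum>i\<in>S. if i = t then x t else 0)"
          unfolding yt using 3 by (intro sum.cong) (auto simp: u_def S_def)
        then show ?thesis using 3 by (simp add: S_def)
      next
        case 4
        then have "x t = 0" using C x by (auto simp: topspace_Euclidean_space)
        moreover have "y t = 0" unfolding yt using 4 jk by (intro sum.neutral) (auto simp: u_def S_def)
        ultimately show ?thesis by simp
      qed
    qed
    then have "x = y" by blast
    then show "x \<in> fs.span (u ` S)" using y by simp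
  qed
  then have "fs.dim C \<le> card (u ` S)" by (rule fs.dim_le_card) (simp add: S_def)
  also have "\<dots> \<le> card S" by (rule card_image_le) (simp add: S_def)
  also have "\<dots> = n + 1 - 2" unfolding S_def using jk ne by (simp add: card_Diff_subset)
  also have "\<dots> < n" using jk ne by linarith
  finally show ?thesis .
qed

lemma dim_less_two_vertex_functionals:
  fixes C :: "(nat \<Rightarrow> real) set"
  assumes C: "C \<subseteq> topspace (Euclidean_space (n + 1))"
    and phi: "\<And>x. x \<in> C \<Longrightarrow> (\<Sum>i\<le>n. x (n - i) * \<phi> i) = 0"
    and psi: "\<And>x. x \<in> C \<Longrightarrow> (\<Sum>i\<le>n. x (n - i) * \<psi> i) = 0"
    and jk: "j \<le> n" "k \<le> n" "\<phi> j * \<psi> k \<noteq> \<phi> k * \<psi> j"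
  shows "fs.dim C < n"
proof -
  have rev: "(\<Sum>i\<le>n. \<theta> (n - i) * x i) = (\<Sum>i\<le>n. x (n - i) * \<theta> i)" for \<theta> x :: "nat \<Rightarrow> real"
    by (rule sum.reindex_bij_witness[of _ "\<lambda>i. n - i" "\<lambda>i. n - i"]) (auto simp: mult.commute)
  show ?thesis
    by (rule dim_less_two_functionals[OF C, where \<phi> = "\<lambda>i. \<phi> (n - i)" and \<psi> = "\<lambda>i. \<psi> (n - i)"
          and j = "n - j" and k = "n - k"])
      (use rev phi psi jk in auto)
qed

text \<open>Suppose that \<open>l f\<close> is non-zero at a point \<open>x\<close> of the cone. For a point \<open>y\<close> with \<open>l f y = 0\<close>, the ray
  from \<open>x\<close> in direction \<open>y\<close> avoids the hyperplane of \<open>f\<close>, so two of its points lie in the same one of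
  the other hyperplanes, which then contains \<open>y\<close>. Hence \<open>f\<close> can be dropped from the covering.\<close>

lemma convex_cone_covered_by_hyperplanes:
  fixes C :: "(nat \<Rightarrow> real) set" and l :: "'f \<Rightarrow> (nat \<Rightarrow> real) \<Rightarrow> real"
  assumes F: "finite F" and ne: "C \<noteq> {}"
    and C: "\<And>x y t. x \<in> C \<Longrightarrow> y \<in> C \<Longrightarrow> 0 \<le> t \<Longrightarrow> (\<lambda>i. x i + t * y i) \<in> C"
    and l: "\<And>f x y t. l f (\<lambda>i. x i + t * y i) = l f x + t * l f y"
    and cover: "\<And>x. x \<in> C \<Longrightarrow> \<exists>f\<in>F. l f x = 0"
  shows "\<exists>f\<in>F. \<forall>x\<in>C. l f x = 0"
  using F cover
proof (induction F rule: finite_induct)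
  case empty
  then show ?case using ne by blast
next
  case (insert f F)
  show ?case
  proof (cases "\<forall>x\<in>C. l f x = 0")
    case True
    then show ?thesis by blast
  next
    case False
    then obtain x where x: "x \<in> C" "l f x \<noteq> 0" by blast
    have "\<exists>g\<in>F. l g y = 0" if y: "y \<in> C" for y
    proof (cases "l f y = 0")
      case False
      then show ?thesis using insert.prems[OF y] by blast
    next
      case True
      have "\<exists>g\<in>F. l g (\<lambda>i. x i + real t * y i) = 0" for t :: nat
        using insert.prems[OF C[OF x(1) y, of "real t"]] l[of f x "real t" y] True x(2) by auto
      then obtain g where g: "\<And>t. g t \<in> F" "\<And>t::nat. l (g t) (\<lambda>i. x i + real t * y i) = 0" by metis
      have "finite (range g)" using g(1) insert.hyps(1) by (meson finite_subset image_subsetI)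
      then have "\<not> inj g" using finite_imageD infinite_UNIV_nat by blast
      then obtain s t where st: "s \<noteq> t" "g s = g t" by (auto simp: inj_on_def)
      have "l (g t) x + real s * l (g t) y = 0" "l (g t) x + real t * l (g t) y = 0"
        using g(2)[of s] g(2)[of t] st(2) by (simp_all add: l)
      then have "(real s - real t) * l (g t) y = 0" unfolding left_diff_distrib by linarith
      then show ?thesis using st(1) g(1) by auto
    qed
    then show ?thesis using insert.IH by blast
  qed
qed

lemma pairing_add: "pairing n (\<lambda>i. v i + t * w i) U = pairing n v U + t * pairing n w U"
  by (simp add: pairing_def sum.distrib sum_distrib_left algebra_simps)

lemma stability_space_cone:
  assumes "v \<in> stability_space n M" "w \<in> stability_space n M" "0 \<le> t"
  shows "(\<lambda>i. v i + t * w i) \<in> stability_space n M"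
  using assms unfolding stability_space_def semistable_def scalar_product_dimvec
  by (auto simp: topspace_Euclidean_space pairing_add mult_nonneg_nonpos add_nonpos_nonpos)

lemma zero_in_stability_space: "(\<lambda>_. 0) \<in> stability_space n M"
  by (simp add: stability_space_def semistable_def scalar_product_dimvec pairing_def
      topspace_Euclidean_space)

lemma interval_sum:
  fixes x :: "nat \<Rightarrow> real"
  assumes "e \<le> n"
  shows "(\<Sum>i\<le>n. x (n - i) * (if c \<le> i \<and> i \<le> e then 1 else 0)) = (\<Sum>i=c..e. x (n - i))"
proof -
  have "(\<Sum>i\<le>n. x (n - i) * (if c \<le> i \<and> i \<le> e then 1 else 0))
      = (\<Sum>i=c..e. x (n - i) * (if c \<le> i \<and> i \<le> e then 1 else 0))"
    using assms by (intro sum.mono_neutral_right) auto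
  then show ?thesis by simp
qed

text \<open>The stability space lies in the hyperplane of some interval and in the one of the dimension vector.
  It spans a hyperplane, so the dimension vector is proportional to the indicator of the interval.\<close>

lemma wall_interval_dims:
  assumes M: "Bmodule n M" "\<not> zero_rep n M" and dim: "fs.dim (stability_space n M) = n"
    and cover: "\<And>v. v \<in> stability_space n M \<Longrightarrow> \<exists>c e. c \<le> e \<and> e \<le> n \<and> (\<Sum>i=c..e. v (n - i)) = 0"
  obtains c e m where "interval_dims n c e m M"
proof -
  \<comment> \<open>The functionals are indexed by the intervals of vertices.\<close>
  let ?F = "{(c, e). c \<le> e \<and> e \<le> n}"
  let ?D = "stability_space n M"
  have "?F \<subseteq> {..n} \<times> {..n}" by auto
  then have "finite ?F" by (rule finite_subset) simp
  then have "\<exists>f\<in>?F. \<forall>v\<in>?D. (\<lambda>(c, e) v. \<Sum>i=c..e. v (n - i)) f v = 0"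
  proof (rule convex_cone_covered_by_hyperplanes)
    show "?D \<noteq> {}" using zero_in_stability_space by blast
    show "\<exists>f\<in>?F. (\<lambda>(c, e) v. \<Sum>i=c..e. v (n - i)) f v = 0" if "v \<in> ?D" for v
      using cover[OF that] by fastforce
  qed (auto intro: stability_space_cone simp: sum.distrib sum_distrib_left split: prod.splits)
  then obtain c e where ce: "c \<le> e" "e \<le> n" "\<And>v. v \<in> ?D \<Longrightarrow> (\<Sum>i=c..e. v (n - i)) = 0" by auto
  let ?\<psi> = "\<lambda>i. if c \<le> i \<and> i \<le> e then 1 else 0 :: real"
  let ?d = "\<lambda>i. real (fs.dim (vsp M i))"
  have propor: "?d j * ?\<psi> k = ?d k * ?\<psi> j" if jk: "j \<le> n" "k \<le> n" for j k
  proof (rule ccontr)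
    assume ne: "?d j * ?\<psi> k \<noteq> ?d k * ?\<psi> j"
    have "fs.dim ?D < n"
    proof (rule dim_less_two_vertex_functionals[OF _ _ _ jk ne])
      show "?D \<subseteq> topspace (Euclidean_space (n + 1))" by (auto simp: stability_space_def)
      fix v assume v: "v \<in> ?D"
      then have "semistable n v M" by (simp add: stability_space_def)
      from semistable_pairing_eq[OF this] show "(\<Sum>i\<le>n. v (n - i) * ?d i) = 0" by (simp add: pairing_def)
      show "(\<Sum>i\<le>n. v (n - i) * ?\<psi> i) = 0" using ce(3)[OF v] interval_sum[OF ce(2)] by simp
    qed
    then show False using dim by simp
  qed
  have d: "fs.dim (vsp M i) = (if c \<le> i \<and> i \<le> e then fs.dim (vsp M c) else 0)" if "i \<le> n" for i
    using propor[of i c] that ce by auto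
  obtain i where i: "i \<le> n" "vsp M i \<noteq> {0}" using M(2) by (auto simp: zero_rep_def)
  have "fs.dim (vsp M i) \<noteq> 0" using dim_eq_0_iff[OF vsp_fin[OF M(1) i(1)]] i(2) by blast
  then have "0 < fs.dim (vsp M c)" using d[OF i(1)] by (metis gr0I)
  then have "interval_dims n c e (fs.dim (vsp M c)) M"
    unfolding interval_dims_def using ce(1,2) d by blast
  then show thesis by (rule that)
qed

text \<open>On a zigzag part \<open>c..q\<close> of \<open>M\<close>, a subspace at the vertex \<open>q\<close> is carried to the left by the bijective
  arrows, as an image or as a preimage, without change of dimension.\<close>

lemma transport_subspace:
  assumes M: "Bmodule n M" and cq: "c \<le> q" "q \<le> n"
    and gaps: "\<And>r. c \<le> r \<Longrightarrow> r < q \<Longrightarrow> gap_down M r \<or> gap_up M r"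
    and W: "fs.subspace W" "W \<subseteq> vsp M q"
  shows "\<exists>K. K q = W \<and>
    (\<forall>r. c \<le> r \<and> r \<le> q \<longrightarrow> fs.subspace (K r) \<and> K r \<subseteq> vsp M r \<and> fs.dim (K r) = fs.dim W) \<and>
    (\<forall>r. c \<le> r \<and> r < q \<longrightarrow> (\<forall>x\<in>K (Suc r). al M r x \<in> K r) \<and> (\<forall>x\<in>K r. be M r x \<in> K (Suc r)))"
  using cq gaps W
proof (induction q arbitrary: W rule: dec_induct)
  case base
  then show ?case by (intro exI[of _ "\<lambda>_. W"]) auto
next
  case (step q)
  have qn: "q < n" using step by simp
  note W = \<open>fs.subspace W\<close> \<open>W \<subseteq> vsp M (Suc q)\<close>
  have fW: "fin_dim_subspace W" using qn by (intro fin_dim_subspace_subset[OF vsp_fin[OF M] W]) auto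
  have sq: "fs.subspace (vsp M q)" "fin_dim_subspace (vsp M q)"
    using vsp_sub[OF M] vsp_fin[OF M] qn by auto
  have "\<exists>W'. fs.subspace W' \<and> W' \<subseteq> vsp M q \<and> fs.dim W' = fs.dim W \<and>
      (\<forall>x\<in>W. al M q x \<in> W') \<and> (\<forall>x\<in>W'. be M q x \<in> W)"
  proof (cases "gap_down M q")
    case True
    have "fs.dim (al M q ` W) = fs.dim W"
      using gap_down_inj[OF True M qn] W(2) by (intro dim_image_inj[OF al_lin[OF M qn] fW]) blast
    moreover have "al M q ` W \<subseteq> vsp M q" using al_in[OF M qn] W(2) by blast
    moreover have "be M q x = 0" if "x \<in> vsp M q" for x using True that by (simp add: gap_down_def)
    ultimately show ?thesis
      using subspace_img[OF al_lin[OF M qn] W(1)] fs.subspace_0[OF W(1)]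
      by (intro exI[of _ "al M q ` W"]) auto
  next
    case False
    then have g: "gap_up M q" using step.prems(2)[of q] step.hyps by simp
    let ?W = "{x \<in> vsp M q. be M q x \<in> W}"
    have s: "fs.subspace ?W" by (rule subspace_preimage[OF be_lin[OF M qn] sq(1) W(1)])
    have img: "be M q ` ?W = W"
    proof
      show "W \<subseteq> be M q ` ?W"
      proof
        fix x assume "x \<in> W"
        moreover from this obtain y where "y \<in> vsp M q" "x = be M q y"
          using W(2) g unfolding gap_up_def bij_betw_def by blast
        ultimately show "x \<in> be M q ` ?W" by blast
      qed
    qed blast
    have "fs.dim (be M q ` ?W) = fs.dim ?W"
      using gap_up_inj[OF g M qn]
      by (intro dim_image_inj[OF be_lin[OF M qn] fin_dim_subspace_subset[OF sq(2) s]]) auto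
    then have "fs.dim ?W = fs.dim W" using img by simp
    moreover have "al M q x \<in> ?W" if "x \<in> W" for x
    proof -
      have "al M q x = 0" using that W(2) g by (auto simp: gap_up_def)
      then show ?thesis using fs.subspace_0[OF s] by simp
    qed
    ultimately show ?thesis using s by (intro exI[of _ ?W]) auto
  qed
  then obtain W' where W': "fs.subspace W'" "W' \<subseteq> vsp M q" "fs.dim W' = fs.dim W"
    "\<And>x. x \<in> W \<Longrightarrow> al M q x \<in> W'" "\<And>x. x \<in> W' \<Longrightarrow> be M q x \<in> W" by blast
  have "gap_down M r \<or> gap_up M r" if "c \<le> r" "r < q" for r
    using step.prems(2)[of r] that by simp
  note IH = step.IH[OF less_imp_le[OF qn] this W'(1,2)]
  obtain K where K: "K q = W'"
    "\<And>r. c \<le> r \<Longrightarrow> r \<le> q \<Longrightarrow> fs.subspace (K r) \<and> K r \<subseteq> vsp M r \<and> fs.dim (K r) = fs.dim W'"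
    "\<And>r. c \<le> r \<Longrightarrow> r < q \<Longrightarrow> (\<forall>x\<in>K (Suc r). al M r x \<in> K r) \<and> (\<forall>x\<in>K r. be M r x \<in> K (Suc r))"
    using IH by metis
  show ?case
  proof (intro exI[of _ "K(Suc q := W)"] conjI allI impI)
    fix r assume r: "c \<le> r \<and> r \<le> Suc q"
    show "fs.subspace ((K(Suc q := W)) r)" "(K(Suc q := W)) r \<subseteq> vsp M r"
      "fs.dim ((K(Suc q := W)) r) = fs.dim W"
      using K(2)[of r] r W W'(3) by (auto simp: le_Suc_eq)
  next
    fix r assume r: "c \<le> r \<and> r < Suc q"
    show "\<forall>x\<in>(K(Suc q := W)) (Suc r). al M r x \<in> (K(Suc q := W)) r"
      "\<forall>x\<in>(K(Suc q := W)) r. be M r x \<in> (K(Suc q := W)) (Suc r)"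
      using K(3)[of r] K(1) r W'(4,5) by (cases "r = q"; simp)+
  qed simp
qed

text \<open>The transported subspaces form, together with either nothing or all of \<open>M\<close> to the right of \<open>q\<close>
  (according to \<open>b\<close>), a submodule. It serves twice: with a kernel of \<open>\<beta>\<^sub>q\<close> it gives a submodule on
  \<open>c..q\<close>, and with an image of \<open>\<alpha>\<^sub>q\<close> the kernel of a quotient living on \<open>c..q\<close>.\<close>

lemma prefix_weight_le:
  assumes M: "Bmodule n M" and dims: "interval_dims n c e m M" and ss: "semistable n v M"
    and q: "c \<le> q" "q < e" and gaps: "\<And>r. c \<le> r \<Longrightarrow> r < q \<Longrightarrow> gap_down M r \<or> gap_up M r"
    and W: "fs.subspace W" "W \<subseteq> vsp M q"
    and up: "b \<Longrightarrow> \<forall>x\<in>vsp M (Suc q). al M q x \<in> W"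
    and down: "\<not> b \<Longrightarrow> \<forall>x\<in>W. be M q x = 0"
  shows "real (fs.dim W) * (\<Sum>i=c..q. v (n - i))
    + (if b then real m * (\<Sum>i=Suc q..e. v (n - i)) else 0) \<le> 0"
proof -
  have d: "e \<le> n" "\<And>i. i \<le> n \<Longrightarrow> fs.dim (vsp M i) = (if c \<le> i \<and> i \<le> e then m else 0)"
    using dims by (auto simp: interval_dims_def)
  obtain K where K: "K q = W"
    "\<And>r. c \<le> r \<Longrightarrow> r \<le> q \<Longrightarrow> fs.subspace (K r) \<and> K r \<subseteq> vsp M r \<and> fs.dim (K r) = fs.dim W"
    "\<And>r x. c \<le> r \<Longrightarrow> r < q \<Longrightarrow> x \<in> K (Suc r) \<Longrightarrow> al M r x \<in> K r"
    "\<And>r x. c \<le> r \<Longrightarrow> r < q \<Longrightarrow> x \<in> K r \<Longrightarrow> be M r x \<in> K (Suc r)"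
    using transport_subspace[OF M q(1) _ gaps W] less_imp_le[OF less_le_trans[OF q(2) d(1)]] by metis
  define U where "U i = (if c \<le> i \<and> i \<le> q then K i else if q < i \<and> b then vsp M i else {0})" for i
  have U: "fs.subspace (U i)" "U i \<subseteq> vsp M i" if "i \<le> n" for i
    using K(2)[of i] vsp_sub[OF M that] fs.subspace_0[OF vsp_sub[OF M that]] by (auto simp: U_def)
  have z: "vsp M i = {0}" if "i \<le> n" "i < c" for i
    using d(2)[of i] that dim_eq_0_iff[OF vsp_fin[OF M that(1)]] by simp
  have "submodule n (M\<lparr>vsp := U\<rparr>) M"
    unfolding submodule_restrict_iff
  proof (intro conjI allI impI ballI)
    fix i x assume i: "i < n"
    have al0: "al M i 0 = 0" and be0: "be M i 0 = 0"
      using flinear_zero[OF al_lin[OF M i]] flinear_zero[OF be_lin[OF M i]] by auto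
    have U0: "0 \<in> U i" "0 \<in> U (Suc i)" using fs.subspace_0[OF U(1)] i by auto
    show "al M i x \<in> U i" if x: "x \<in> U (Suc i)"
    proof -
      have xM: "x \<in> vsp M (Suc i)" using U(2)[of "Suc i"] x i by auto
      consider "i < c" | "c \<le> i" "i < q" | "i = q" | "q < i" by linarith
      then show ?thesis
      proof cases
        case 1
        then have "al M i x = 0" using al_in[OF M i xM] z[of i] i by auto
        then show ?thesis using U0 by simp
      next
        case 2
        then show ?thesis using K(3)[of i x] x by (simp add: U_def)
      next
        case 3
        then show ?thesis using x up q K(1) al0 U0 xM by (cases b) (auto simp: U_def)
      next
        case 4
        then show ?thesis using x al_in[OF M i xM] al0 by (auto simp: U_def split: if_splits)
      qed
    qed
    show "be M i x \<in> U (Suc i)" if x: "x \<in> U i"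
    proof -
      have xM: "x \<in> vsp M i" using U(2)[of i] x i by auto
      consider "i < c" | "c \<le> i" "i < q" | "i = q" | "q < i" by linarith
      then show ?thesis
      proof cases
        case 1
        then have "be M i x = 0" using xM z[of i] i be0 by auto
        then show ?thesis using U0 by simp
      next
        case 2
        then show ?thesis using K(4)[of i x] x by (simp add: U_def)
      next
        case 3
        then show ?thesis using x down q K(1) be_in[OF M i xM] by (cases b) (auto simp: U_def)
      next
        case 4
        then show ?thesis using x be_in[OF M i xM] be0 by (auto simp: U_def split: if_splits)
      qed
    qed
  qed (use U in auto)
  then have "pairing n v U \<le> 0" using semistable_submodule_le[OF ss] by fastforce
  also have "pairing n v U = (\<Sum>i=c..e. v (n - i) * real (fs.dim (U i)))"
    using d q by (intro pairing_interval) (auto simp: U_def)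
  also have "\<dots> = (\<Sum>i=c..q. v (n - i) * real (fs.dim (U i))) + (\<Sum>i=Suc q..e. v (n - i) * real (fs.dim (U i)))"
    using q sum.ub_add_nat[of c q "\<lambda>i. v (n - i) * real (fs.dim (U i))" "e - q"]
    by (simp del: sum.cl_ivl_Suc)
  also have "(\<Sum>i=c..q. v (n - i) * real (fs.dim (U i))) = (\<Sum>i=c..q. v (n - i) * real (fs.dim W))"
    using K(2) by (intro sum.cong) (auto simp: U_def)
  also have "(\<Sum>i=Suc q..e. v (n - i) * real (fs.dim (U i)))
      = (if b then \<Sum>i=Suc q..e. v (n - i) * real m else 0)"
    using d q by (auto simp: U_def intro!: sum.cong)
  finally show ?thesis
    by (auto simp: sum_distrib_left mult.commute split: if_splits)
qed

text \<open>If \<open>\<beta>\<^sub>q\<close> is not injective and \<open>\<alpha>\<^sub>q\<close> is not surjective, the segment \<open>c..q\<close> has weight \<open>0\<close> throughout the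
  stability space, which is one linear equation too many. Otherwise one of the two arrows is
  bijective, by equality of dimensions, and \<open>\<alpha>\<^sub>q\<beta>\<^sub>q = 0\<close> forces the other one to be zero.\<close>

lemma wall_gap:
  assumes M: "Bmodule n M" and dims: "interval_dims n c e m M"
    and dim: "fs.dim (stability_space n M) = n"
    and q: "c \<le> q" "q < e" and gaps: "\<And>r. c \<le> r \<Longrightarrow> r < q \<Longrightarrow> gap_down M r \<or> gap_up M r"
  shows "gap_down M q \<or> gap_up M q"
proof -
  have d: "e \<le> n" "0 < m" "\<And>i. i \<le> n \<Longrightarrow> fs.dim (vsp M i) = (if c \<le> i \<and> i \<le> e then m else 0)"
    using dims by (auto simp: interval_dims_def)
  have qn: "q < n" using q d by simp
  let ?V = "vsp M q" and ?V' = "vsp M (Suc q)" and ?a = "al M q" and ?b = "be M q"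
  have dV: "fs.dim ?V = m" "fs.dim ?V' = m" using d q qn by auto
  have sV: "fs.subspace ?V" "fs.subspace ?V'" "fin_dim_subspace ?V" "fin_dim_subspace ?V'"
    using vsp_sub[OF M] vsp_fin[OF M] qn by auto
  note la = al_lin[OF M qn] and lb = be_lin[OF M qn]
  \<comment> \<open>At the left end there is nothing below \<open>c\<close>; elsewhere \<open>\<alpha>\<^sub>q\<beta>\<^sub>q = \<beta>\<^bsub>q-1\<^esub>\<alpha>\<^bsub>q-1\<^esub>\<close> and the previous gap kills it.\<close>
  have ab: "?a (?b x) = 0" if x: "x \<in> ?V" for x
  proof (cases q)
    case 0
    then show ?thesis using al_be_0[OF M] x by simp
  next
    case (Suc k)
    have k: "k < n" "Suc k < n" using Suc qn by auto
    have xk: "x \<in> vsp M (Suc k)" using x Suc by simp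
    have "be M k (al M k x) = 0"
    proof (cases "c \<le> k")
      case True
      then have "gap_down M k \<or> gap_up M k" using gaps Suc by simp
      then show ?thesis
      proof
        assume "gap_down M k"
        then show ?thesis using al_in[OF M k(1) xk] by (simp add: gap_down_def)
      next
        assume "gap_up M k"
        then have "al M k x = 0" using xk by (simp add: gap_up_def)
        then show ?thesis using flinear_zero[OF be_lin[OF M k(1)]] by simp
      qed
    next
      case False
      then have "fs.dim (vsp M k) = 0" using d(3)[of k] k by simp
      then have "vsp M k = {0}" using dim_eq_0_iff[OF vsp_fin[OF M]] k by simp
      then have "al M k x = 0" using al_in[OF M k(1) xk] by simp
      then show ?thesis using flinear_zero[OF be_lin[OF M k(1)]] by simp
    qed
    then show ?thesis using be_al[OF M k(2) xk] Suc by simp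
  qed
  show ?thesis
  proof (cases "(\<exists>x\<in>?V. ?b x = 0 \<and> x \<noteq> 0) \<and> ?a ` ?V' \<noteq> ?V")
    case True
    let ?K = "{x \<in> ?V. ?b x = 0}" and ?I = "?a ` ?V'"
    have sK: "fs.subspace ?K" by (rule subspace_ker[OF lb sV(1)])
    have sI: "fs.subspace ?I" "?I \<subseteq> ?V" using subspace_img[OF la sV(2)] al_in[OF M qn] by auto
    have "?K \<noteq> {0}" using True by blast
    then have K0: "0 < fs.dim ?K"
      using dim_eq_0_iff[OF fin_dim_subspace_subset[OF sV(3) sK]] by blast
    have Im: "fs.dim ?I < m" using dim_less_fin[OF sV(3) sI] True dV by simp
    have both: "(\<Sum>i=c..q. v (n - i)) = 0 \<and> (\<Sum>i=c..e. v (n - i)) = 0" if v: "v \<in> stability_space n M" for v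
    proof -
      have ss: "semistable n v M" using v by (simp add: stability_space_def)
      have "real (fs.dim ?K) * (\<Sum>i=c..q. v (n - i))
          + (if False then real m * (\<Sum>i=Suc q..e. v (n - i)) else 0) \<le> 0"
        by (rule prefix_weight_le[OF M dims ss q gaps sK]) auto
      then have "real (fs.dim ?K) * (\<Sum>i=c..q. v (n - i)) \<le> 0" by simp
      then have le: "(\<Sum>i=c..q. v (n - i)) \<le> 0" using K0 by (simp add: mult_le_0_iff)
      have "real (fs.dim ?I) * (\<Sum>i=c..q. v (n - i))
          + (if True then real m * (\<Sum>i=Suc q..e. v (n - i)) else 0) \<le> 0"
        by (rule prefix_weight_le[OF M dims ss q gaps sI]) auto
      then have 1: "real (fs.dim ?I) * (\<Sum>i=c..q. v (n - i)) + real m * (\<Sum>i=Suc q..e. v (n - i)) \<le> 0"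
        by simp
      have tot: "(\<Sum>i=c..e. v (n - i)) = 0"
      proof -
        have "0 = (\<Sum>i=c..e. v (n - i) * real (fs.dim (vsp M i)))"
          using semistable_pairing_eq[OF ss] pairing_interval[OF d(1), of c "vsp M" v] d(3) by metis
        also have "\<dots> = (\<Sum>i=c..e. v (n - i) * real m)" using d by (intro sum.cong) auto
        finally show ?thesis using d(2) by (simp add: sum_distrib_right[symmetric])
      qed
      have "(\<Sum>i=c..e. v (n - i)) = (\<Sum>i=c..q. v (n - i)) + (\<Sum>i=Suc q..e. v (n - i))"
        using sum.ub_add_nat[of c q "\<lambda>i. v (n - i)" "e - q"] q by (simp del: sum.cl_ivl_Suc)
      then have "(\<Sum>i=Suc q..e. v (n - i)) = - (\<Sum>i=c..q. v (n - i))" using tot by linarith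
      with 1 have "(real (fs.dim ?I) - real m) * (\<Sum>i=c..q. v (n - i)) \<le> 0"
        by (simp add: left_diff_distrib)
      then have "0 \<le> (\<Sum>i=c..q. v (n - i))" using Im by (simp add: mult_le_0_iff)
      then show ?thesis using le tot by simp
    qed
    have "fs.dim (stability_space n M) < n"
    proof (rule dim_less_two_vertex_functionals[where \<phi> = "\<lambda>i. if c \<le> i \<and> i \<le> q then 1 else 0"
          and \<psi> = "\<lambda>i. if c \<le> i \<and> i \<le> e then 1 else 0" and j = c and k = e])
      show "stability_space n M \<subseteq> topspace (Euclidean_space (n + 1))" by (auto simp: stability_space_def)
    qed (use both interval_sum[of q n] interval_sum[of e n] q qn d(1) in auto)
    then show ?thesis using dim by simp
  next
    case False
    then consider (inj) "\<forall>x\<in>?V. ?b x = 0 \<longrightarrow> x = 0" | (surj) "?a ` ?V' = ?V" by blast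
    then show ?thesis
    proof cases
      case inj
      then have "fs.dim (?b ` ?V) = fs.dim ?V'"
        using dim_image_inj[OF lb sV(3)] dV by simp
      then have im: "?b ` ?V = ?V'"
        using be_in[OF M qn] by (intro dim_eq_fin[OF sV(4) subspace_img[OF lb sV(1)]]) auto
      moreover have "inj_on ?b ?V" using inj inj_on_ker[OF lb sV(1)] by blast
      moreover have "\<forall>x\<in>?V'. ?a x = 0" unfolding im[symmetric] using ab by simp
      ultimately show ?thesis by (simp add: gap_up_def bij_betw_def)
    next
      case surj
      then have "fs.dim {x \<in> ?V'. ?a x = 0} = 0" using rank_nullity[OF la sV(4)] dV by simp
      then have k: "{x \<in> ?V'. ?a x = 0} = {0}"
        using dim_eq_0_iff[OF fin_dim_subspace_subset[OF sV(4) subspace_ker[OF la sV(2)]]] by blast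
      then have "inj_on ?a ?V'" unfolding inj_on_ker[OF la sV(2)] by blast
      moreover have "\<forall>x\<in>?V. ?b x = 0"
      proof
        fix x assume "x \<in> ?V"
        then have "?b x \<in> {x \<in> ?V'. ?a x = 0}" using ab be_in[OF M qn] by simp
        then show "?b x = 0" unfolding k by simp
      qed
      ultimately show ?thesis using surj by (simp add: gap_down_def bij_betw_def)
    qed
  qed
qed

lemma wall_zigzag:
  assumes M: "Bmodule n M" and dims: "interval_dims n c e m M"
    and dim: "fs.dim (stability_space n M) = n"
  obtains p where "zigzag n c e p m M"
proof -
  have "c \<le> q \<Longrightarrow> q < e \<Longrightarrow> gap_down M q \<or> gap_up M q" for q
  proof (induction q rule: less_induct)
    case (less q)
    show ?case by (rule wall_gap[OF M dims dim less.prems]) (use less in auto)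
  qed
  then show thesis using gaps_alternate[OF M dims] that by blast
qed

section \<open>The wall and chamber structure\<close>

theorem proposition5p8:
  fixes n :: nat
  assumes "n \<ge> 1"
  shows "wall_chamber_structure n (indecomposables n :: 'k::alg_closed_field rep set) =
         wall_chamber_structure n (thin_indecomposables n :: 'k rep set)"
proof -
  let ?I = "indecomposables n :: 'k rep set" and ?T = "thin_indecomposables n :: 'k rep set"
  have TI: "?T \<subseteq> ?I" by (auto simp: thin_indecomposables_def)
  have I: "Bmodule n M" "\<not> zero_rep n M" if "M \<in> ?I" for M
    using that by (auto simp: indecomposables_def indecomposable_def)
  have cone: "\<exists>T\<in>?T. stability_space n T = zigzag_cone n c e p" if "c \<le> e" "e \<le> n" for c e p
    using zigzag_rep_thin_indecomposable[OF that, of p] stability_space_zigzag_rep[OF that, of p] by blast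
  have "(\<Union>M\<in>?I. stability_space n M) = (\<Union>M\<in>?T. stability_space n M)"
  proof
    show "(\<Union>M\<in>?I. stability_space n M) \<subseteq> (\<Union>M\<in>?T. stability_space n M)"
    proof
      fix v assume "v \<in> (\<Union>M\<in>?I. stability_space n M)"
      then obtain M where M: "M \<in> ?I" "v \<in> stability_space n M" by blast
      obtain c e p where c: "c \<le> e" "e \<le> n" "v \<in> zigzag_cone n c e p"
        by (rule semistable_in_zigzag_cone[OF I[OF M(1)] M(2)])
      then show "v \<in> (\<Union>M\<in>?T. stability_space n M)" using cone[OF c(1,2), of p] by blast
    qed
  qed (use TI in blast)
  then have "chambers n ?I = chambers n ?T" by (simp add: chambers_def)
  moreover have "walls n ?I = walls n ?T"
  proof
    show "walls n ?I \<subseteq> walls n ?T"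
    proof
      fix D assume "D \<in> walls n ?I"
      then obtain M where M: "M \<in> ?I" "D = stability_space n M" "codimension n (stability_space n M) = 1"
        by (auto simp: walls_def)
      have dim: "fs.dim (stability_space n M) = n" using M(3) by (simp add: codimension_def)
      have cover: "\<exists>c e. c \<le> e \<and> e \<le> n \<and> (\<Sum>i=c..e. v (n - i)) = 0"
        if v: "v \<in> stability_space n M" for v
      proof -
        obtain c e p where "c \<le> e" "e \<le> n" "v \<in> zigzag_cone n c e p"
          by (rule semistable_in_zigzag_cone[OF I[OF M(1)] v])
        then show ?thesis by (auto simp: zigzag_cone_def)
      qed
      obtain c e m where dims: "interval_dims n c e m M"
        by (rule wall_interval_dims[OF I[OF M(1)] dim cover])
      obtain p where z: "zigzag n c e p m M" by (rule wall_zigzag[OF I(1)[OF M(1)] dims dim])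
      have ce: "c \<le> e" "e \<le> n" using dims by (auto simp: interval_dims_def)
      obtain T where T: "T \<in> ?T" "stability_space n T = zigzag_cone n c e p"
        using cone[OF ce, of p] by blast
      have D: "D = stability_space n T"
        unfolding M(2) T(2) by (rule stability_space_zigzag[OF I(1)[OF M(1)] z])
      then have "codimension n (stability_space n T) = 1" using M(2,3) by simp
      then show "D \<in> walls n ?T" unfolding walls_def using T(1) D by blast
    qed
    show "walls n ?T \<subseteq> walls n ?I" using TI unfolding walls_def by blast
  qed
  ultimately show ?thesis by (simp add: wall_chamber_structure_def)
qed

end
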